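(* Let $d\ge1$, $\alpha\in(0,+\infty)$ with $\alpha\ne1$, and $S(t)=e^{-it|D_x|^\alpha}$. Let $s,\sigma\in\mathbf R$. Assume that there exists $t_0\ne0$ such that $S(t_0)$ is continuous from $C^\sigma_*(\mathbf R^d)$ to $C^s_*(\mathbf R^d)$. Then $s\le\sigma-\frac{d\alpha}{2}$.
   Context: $S(t)$ is the Fourier multiplier with symbol $e^{-it|\xi|^\alpha}$. $C^\sigma_*(\mathbf R^d)$ is the Zygmund space, with norm $\sup_j2^{j\sigma}\|\Delta_ju\|_{L^\infty(\mathbf R^d)}$ where $(\Delta_j)$ are the usual inhomogeneous Littlewood-Paley dyadic blocks. *)

theory Defs
  imports "HOL-Analysis.Analysis"
begin

text \<open>
  Throughout, \<open>\<real>\<^sup>d\<close> is a Euclidean space \<open>'a\<close> with \<open>d = DIM('a)\<close>.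
\<close>

definition partial_derivs :: "'a::euclidean_space list \<Rightarrow> ('a \<Rightarrow> complex) \<Rightarrow> 'a \<Rightarrow> complex" where
  "partial_derivs bs f = foldr (\<lambda>b g x. frechet_derivative g (at x) b) bs f"

definition smooth :: "('a::euclidean_space \<Rightarrow> complex) \<Rightarrow> bool" where
  "smooth f \<longleftrightarrow> (\<forall>bs\<in>lists Basis. \<forall>x. partial_derivs bs f differentiable at x)"

definition test_function :: "('a::euclidean_space \<Rightarrow> complex) \<Rightarrow> bool" where
  "test_function f \<longleftrightarrow> smooth f \<and> (\<exists>R. \<forall>x. R < norm x \<longrightarrow> f x = 0)"

definition schwartz :: "('a::euclidean_space \<Rightarrow> complex) \<Rightarrow> bool" where
  "schwartz f \<longleftrightarrow> smooth f \<and>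
     (\<forall>bs\<in>lists Basis. \<forall>k. bounded (range (\<lambda>x. (1 + norm x) ^ k * norm (partial_derivs bs f x))))"

definition schwartz_seminorm :: "nat \<Rightarrow> ('a::euclidean_space \<Rightarrow> complex) \<Rightarrow> real" where
  "schwartz_seminorm N f =
     (\<Sum>bs | set bs \<subseteq> Basis \<and> length bs \<le> N. SUP x. (1 + norm x) ^ N * norm (partial_derivs bs f x))"

text \<open>
  A tempered distribution is represented by a functional on all functions; only its values on
  Schwartz functions are relevant.
\<close>

type_synonym 'a dist = "('a \<Rightarrow> complex) \<Rightarrow> complex"

definition tempered :: "'a::euclidean_space dist \<Rightarrow> bool" where
  "tempered u \<longleftrightarrow>
     (\<forall>f g. schwartz f \<longrightarrow> schwartz g \<longrightarrow> u (\<lambda>x. f x + g x) = u f + u g) \<and>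
     (\<forall>c f. schwartz f \<longrightarrow> u (\<lambda>x. c * f x) = c * u f) \<and>
     (\<exists>C N. \<forall>f. schwartz f \<longrightarrow> norm (u f) \<le> C * schwartz_seminorm N f)"

definition dist_diff :: "'a dist \<Rightarrow> 'a dist \<Rightarrow> 'a dist" where
  "dist_diff u v = (\<lambda>f. u f - v f)"

definition inv_fourier :: "('a::euclidean_space \<Rightarrow> complex) \<Rightarrow> 'a \<Rightarrow> complex" where
  "inv_fourier p x = (LINT \<xi>|lborel. p \<xi> * cis (x \<bullet> \<xi>)) / complex_of_real ((2 * pi) ^ DIM('a))"

text \<open>
  For a test function \<open>p\<close>, the distribution \<open>p(D)u\<close> with Fourier transform \<open>p \<cdot> \<hat>u\<close> is the smooth
  function \<open>(F\<^sup>-\<^sup>1 p) * u\<close>, the convolution of a Schwartz function with \<open>u\<close>.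
\<close>

definition smooth_multiplier :: "('a::euclidean_space \<Rightarrow> complex) \<Rightarrow> 'a dist \<Rightarrow> 'a \<Rightarrow> complex" where
  "smooth_multiplier p u x = u (\<lambda>y. inv_fourier p (x - y))"

text \<open>
  The cutoff \<open>\<psi>\<close> generating a dyadic partition of unity. The radii \<open>r < R\<close> are left free since
  they vary among the usual conventions; the resulting Zygmund norms are equivalent.
  Block \<open>0\<close> is the low-frequency block (often indexed by \<open>-1\<close>).
\<close>

definition lp_cutoff :: "('a::euclidean_space \<Rightarrow> real) \<Rightarrow> bool" where
  "lp_cutoff \<psi> \<longleftrightarrow>
     smooth (\<lambda>\<xi>. complex_of_real (\<psi> \<xi>)) \<and>
     (\<forall>\<xi>. 0 \<le> \<psi> \<xi> \<and> \<psi> \<xi> \<le> 1) \<and>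
     (\<forall>\<xi> \<zeta>. norm \<xi> = norm \<zeta> \<longrightarrow> \<psi> \<xi> = \<psi> \<zeta>) \<and>
     (\<exists>r R. 0 < r \<and> r < R \<and> (\<forall>\<xi>. norm \<xi> \<le> r \<longrightarrow> \<psi> \<xi> = 1) \<and> (\<forall>\<xi>. R \<le> norm \<xi> \<longrightarrow> \<psi> \<xi> = 0))"

definition lp_symbol :: "('a::euclidean_space \<Rightarrow> real) \<Rightarrow> nat \<Rightarrow> 'a \<Rightarrow> complex" where
  "lp_symbol \<psi> j \<xi> =
     complex_of_real (if j = 0 then \<psi> \<xi> else \<psi> (\<xi> /\<^sub>R 2 ^ j) - \<psi> (\<xi> /\<^sub>R 2 ^ (j - 1)))"

definition lp_block :: "('a::euclidean_space \<Rightarrow> real) \<Rightarrow> nat \<Rightarrow> 'a dist \<Rightarrow> 'a \<Rightarrow> complex" where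
  "lp_block \<psi> j u = smooth_multiplier (lp_symbol \<psi> j) u"

text \<open>The blocks are continuous functions, so the supremum is the \<open>L\<^sup>\<infinity>\<close> norm.\<close>

definition sup_norm :: "('a \<Rightarrow> complex) \<Rightarrow> ennreal" where
  "sup_norm f = (SUP x. ennreal (norm (f x)))"

definition zygmund_norm :: "('a::euclidean_space \<Rightarrow> real) \<Rightarrow> real \<Rightarrow> 'a dist \<Rightarrow> ennreal" where
  "zygmund_norm \<psi> \<sigma> u = (SUP j. ennreal (2 powr (real j * \<sigma>)) * sup_norm (lp_block \<psi> j u))"

definition zygmund_space :: "('a::euclidean_space \<Rightarrow> real) \<Rightarrow> real \<Rightarrow> 'a dist set" where
  "zygmund_space \<psi> \<sigma> = {u. tempered u \<and> zygmund_norm \<psi> \<sigma> u < \<infinity>}"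

text \<open>
  The graph of the Fourier multiplier \<open>m(D)\<close>: \<open>v = m(D)u\<close>. A symbol such as
  \<open>exp(-it|\<xi>|\<^sup>\<alpha>)\<close> need not be smooth at \<open>0\<close>, so \<open>m \<cdot> \<hat>u\<close> is not defined as the product of a smooth
  function and a distribution. It is given a meaning frequency-locally: for test functions \<open>\<theta>\<close>, \<open>\<eta>\<close>
  with \<open>\<eta> = 1\<close> where \<open>\<theta> \<noteq> 0\<close>,
  \<open>\<theta>(D)v = (m\<theta>)(D)u = (m\<theta>)(D) \<eta>(D)u = F\<^sup>-\<^sup>1(m\<theta>) * \<eta>(D)u\<close>.
  For \<open>u\<close> in a Zygmund space and this symbol, with \<open>\<alpha> > 0\<close>, the last expression is the convolution of
  an integrable function with a bounded one. These identities determine \<open>v\<close> on Schwartz functions.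
\<close>

definition fourier_multiplier ::
    "('a::euclidean_space \<Rightarrow> complex) \<Rightarrow> 'a dist \<Rightarrow> 'a dist \<Rightarrow> bool" where
  "fourier_multiplier m u v \<longleftrightarrow> tempered u \<and> tempered v \<and>
     (\<forall>\<theta> \<eta>. test_function \<theta> \<longrightarrow> test_function \<eta> \<longrightarrow> (\<forall>\<xi>. \<theta> \<xi> \<noteq> 0 \<longrightarrow> \<eta> \<xi> = 1) \<longrightarrow>
       (\<forall>x. smooth_multiplier \<theta> v x =
          (LINT y|lborel. inv_fourier (\<lambda>\<xi>. m \<xi> * \<theta> \<xi>) y * smooth_multiplier \<eta> u (x - y))))"

definition propagator :: "real \<Rightarrow> real \<Rightarrow> 'a::euclidean_space dist \<Rightarrow> 'a dist \<Rightarrow> bool" where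
  "propagator \<alpha> t = fourier_multiplier (\<lambda>\<xi>. cis (- (t * norm \<xi> powr \<alpha>)))"

text \<open>
  Continuity, for the norm topologies, of an operator given by its graph \<open>T\<close>; the first conjunct
  says that the operator is defined on the whole source space and maps it into the target space.
\<close>

definition zygmund_continuous ::
    "('a::euclidean_space \<Rightarrow> real) \<Rightarrow> ('a dist \<Rightarrow> 'a dist \<Rightarrow> bool) \<Rightarrow> real \<Rightarrow> real \<Rightarrow> bool" where
  "zygmund_continuous \<psi> T \<sigma> s \<longleftrightarrow>
     (\<forall>u\<in>zygmund_space \<psi> \<sigma>. \<exists>v\<in>zygmund_space \<psi> s. T u v) \<and>
     (\<forall>u\<in>zygmund_space \<psi> \<sigma>. \<forall>v. T u v \<longrightarrow>
       (\<forall>\<epsilon>>0. \<exists>\<delta>>0. \<forall>u'\<in>zygmund_space \<psi> \<sigma>. \<forall>v'. T u' v' \<longrightarrow>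
          zygmund_norm \<psi> \<sigma> (dist_diff u' u) < ennreal \<delta> \<longrightarrow>
          zygmund_norm \<psi> s (dist_diff v' v) < ennreal \<epsilon>))"

end

theory Submission
  imports Defs "HOL-Probability.Probability"
begin

text \<open>
  Choose \<open>u\<close> as a superposition of about \<open>\<lambda>\<^sup>d\<^sup>\<alpha>\<^sup>/\<^sup>2\<close> wave packets with frequencies near \<open>\<lambda> \<kappa>\<close>, where
  \<open>\<lambda> = 2\<^sup>j\<close> and \<open>\<kappa>\<close> ranges over a fixed ball away from \<open>0\<close>, each of frequency width
  \<open>r = \<lambda>\<^sup>1\<^sup>-\<^sup>\<alpha>\<^sup>/\<^sup>2 / K\<close>. At this width \<open>t\<^sub>0|\<xi>|\<^sup>\<alpha>\<close> differs from its linearization at \<open>\<lambda> \<kappa>\<close> by at most \<open>1\<close> on a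
  packet, so \<open>S(t\<^sub>0)\<close> merely translates it by \<open>t\<^sub>0\<close> times the gradient. The packets are placed so that after
  time \<open>t\<^sub>0\<close> all of them sit at the origin, in phase. Since \<open>\<alpha> \<noteq> 1\<close>, the gradient of \<open>|\<xi>|\<^sup>\<alpha>\<close> is expanding on
  annuli, and before time \<open>t\<^sub>0\<close> the packets are essentially disjoint. Hence \<open>|S(t\<^sub>0)u(0)|\<close> exceeds
  \<open>sup |u|\<close> by a factor comparable to their number. No stationary phase estimate is needed, nor
  smoothness of \<open>|\<xi>|\<^sup>\<alpha>\<close>: the multiplier only acts on an integrable \<open>u\<close> with continuous,
  compactly supported Fourier transform.
\<close>

section \<open>Integration on Euclidean spaces\<close>

text \<open>The size of \<open>r\<close> results from a trade-off. With packets superposed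
  continuously in \<kappa>, the bound on sup |u| is of order \<nu>^(-d), where 2 \<nu> is the
  expansion constant of \<open>V\<close> on \<open>B\<close>; it does not contain \<open>r\<close>.
  The value at the origin after time t0 is of order r^d. The gain (r \<nu>)^d favours wide packets,
  and the linearization error, of order |t0| \<lambda>^\<alpha> (r/\<lambda>)^2, caps
  \<open>r\<close> at the order \<lambda>^(1 - \<alpha>/2). As \<nu> has order \<lambda>^(\<alpha> -
  1), the gain is \<lambda>^(d \<alpha>/2). For \<alpha> = 1 the gradient \<xi>/|\<xi>| is constant
  along rays, and packets on one ray would not be separated.

  Integrating over \<kappa> instead of summing replaces the counting of packets by a change of
  variables. The superposition is prescribed on the Fourier side, so its transform must be recovered
  from the function in physical space; this is why an inversion theorem is proved.\<close>

lemma borel_measurable_integrable_lborel: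
  fixes f :: "'a::euclidean_space \<Rightarrow> 'b::{banach, second_countable_topology}"
  shows "integrable lborel f \<Longrightarrow> f \<in> borel_measurable borel"
  by (drule borel_measurable_integrable) simp

section \<open>Affine changes of variables\<close>

lemma integrable_lborel_affine:
  fixes f :: "'a::euclidean_space \<Rightarrow> 'b::{banach, second_countable_topology}"
  assumes "c \<noteq> 0" "integrable lborel f"
  shows "integrable lborel (\<lambda>x. f (t + c *\<^sub>R x))"
proof -
  have [measurable]: "f \<in> borel_measurable borel"
    using assms(2) by (rule borel_measurable_integrable_lborel)
  have "integrable (density (distr lborel borel (\<lambda>x. t + c *\<^sub>R x)) (\<lambda>_. ennreal (\<bar>c\<bar>^DIM('a)))) f"
    using assms lborel_affine[OF assms(1), of t] by simp
  then have "integrable (distr lborel borel (\<lambda>x. t + c *\<^sub>R x)) (\<lambda>x. (\<bar>c\<bar>^DIM('a)) *\<^sub>R f x)"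
    by (simp add: integrable_density)
  then have "integrable lborel (\<lambda>x. (\<bar>c\<bar>^DIM('a)) *\<^sub>R f (t + c *\<^sub>R x))"
    by (subst (asm) integrable_distr_eq) auto
  from integrable_scaleR_right[OF this, of "inverse (\<bar>c\<bar>^DIM('a))"] show ?thesis
    using assms(1) by simp
qed

lemma integrable_lborel_affine_iff:
  fixes f :: "'a::euclidean_space \<Rightarrow> 'b::{banach, second_countable_topology}"
  assumes "c \<noteq> 0"
  shows "integrable lborel (\<lambda>x. f (t + c *\<^sub>R x)) \<longleftrightarrow> integrable lborel f"
  using integrable_lborel_affine[OF assms, of f t]
    integrable_lborel_affine[of "inverse c" "\<lambda>x. f (t + c *\<^sub>R x)" "- (inverse c *\<^sub>R t)"] assms
  by (auto simp: algebra_simps)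

text \<open>If \<open>f\<close> is not integrable, neither is its composition with the affine map,
  and both integrals take the default value 0.\<close>

lemma integral_lborel_affine:
  fixes f :: "'a::euclidean_space \<Rightarrow> 'b::{banach, second_countable_topology}"
  assumes "c \<noteq> 0"
  shows "(LINT x|lborel. f x) = \<bar>c\<bar>^DIM('a) *\<^sub>R (LINT x|lborel. f (t + c *\<^sub>R x))"
proof (cases "integrable lborel f")
  case True
  then have [measurable]: "f \<in> borel_measurable borel"
    using borel_measurable_integrable by fastforce
  have "(LINT x|lborel. f x) =
      integral\<^sup>L (density (distr lborel borel (\<lambda>x. t + c *\<^sub>R x)) (\<lambda>_. ennreal (\<bar>c\<bar>^DIM('a)))) f"
    using lborel_affine[OF assms(1), of t] by simp
  also have "\<dots> = integral\<^sup>L (distr lborel borel (\<lambda>x. t + c *\<^sub>R x)) (\<lambda>x. (\<bar>c\<bar>^DIM('a)) *\<^sub>R f x)"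
    by (subst integral_density) auto
  also have "\<dots> = (LINT x|lborel. (\<bar>c\<bar>^DIM('a)) *\<^sub>R f (t + c *\<^sub>R x))"
    by (subst integral_distr) auto
  finally show ?thesis by simp
next
  case False
  then show ?thesis
    using integrable_lborel_affine_iff[OF assms, of f t]
    by (simp add: not_integrable_integral_eq)
qed

lemma integral_lborel_reflect:
  fixes f :: "'a::euclidean_space \<Rightarrow> 'b::{banach, second_countable_topology}"
  shows "(LINT y|lborel. f (x - y)) = (LINT y|lborel. f y)"
  using integral_lborel_affine[of "-1" f x] by simp

lemma integrable_lborel_reflect:
  fixes f :: "'a::euclidean_space \<Rightarrow> 'b::{banach, second_countable_topology}"
  shows "integrable lborel (\<lambda>y. f (x - y)) \<longleftrightarrow> integrable lborel f"
  using integrable_lborel_affine_iff[of "-1" f x] by simp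

lemma integral_lborel_translate:
  fixes f :: "'a::euclidean_space \<Rightarrow> 'b::{banach, second_countable_topology}"
  shows "(LINT y|lborel. f (x + y)) = (LINT y|lborel. f y)"
  using integral_lborel_affine[of 1 f x] by simp

lemma integrable_lborel_translate:
  fixes f :: "'a::euclidean_space \<Rightarrow> 'b::{banach, second_countable_topology}"
  shows "integrable lborel (\<lambda>y. f (x + y)) \<longleftrightarrow> integrable lborel f"
  using integrable_lborel_affine_iff[of 1 f x] by simp

text \<open>Reduces d-dimensional integrals to one-dimensional ones. It is applied to a product
  majorant of \<open>peak\<close> and to the Gaussian.\<close>

lemma
  fixes f :: "'a::euclidean_space \<Rightarrow> real \<Rightarrow> 'b::{real_normed_field, banach, second_countable_topology}"
  assumes "\<And>b. b \<in> Basis \<Longrightarrow> integrable lborel (f b)"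
  shows integrable_lborel_prod: "integrable lborel (\<lambda>x::'a. \<Prod>b\<in>Basis. f b (x \<bullet> b))"
    and integral_lborel_prod: "(LINT x|lborel. (\<Prod>b\<in>Basis. f b (x \<bullet> b))) = (\<Prod>b\<in>Basis. (LINT y|lborel. f b y))"
proof -
  interpret product_sigma_finite "\<lambda>_::'a. lborel :: real measure" ..
  have m[measurable]: "f b \<in> borel_measurable borel" if "b \<in> Basis" for b
    using assms[OF that] borel_measurable_integrable by fastforce
  have eq: "(\<Prod>b\<in>Basis. f b ((\<Sum>c\<in>Basis. g c *\<^sub>R c) \<bullet> b)) = (\<Prod>b\<in>Basis. f b (g b))" for g :: "'a \<Rightarrow> real"
    by (intro prod.cong) auto
  have i: "integrable (Pi\<^sub>M Basis (\<lambda>_. lborel)) (\<lambda>g. \<Prod>b\<in>Basis. f b (g b))"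
    by (rule product_integrable_prod) (auto intro: assms)
  show "integrable lborel (\<lambda>x::'a. \<Prod>b\<in>Basis. f b (x \<bullet> b))"
    by (subst lborel_eq, subst integrable_distr_eq) (use i in \<open>simp_all add: eq\<close>)
  show "(LINT x|lborel. (\<Prod>b\<in>Basis. f b (x \<bullet> b))) = (\<Prod>b\<in>Basis. (LINT y|lborel. f b y))"
    by (subst lborel_eq, subst integral_distr) (use assms in \<open>simp_all add: eq product_integral_prod\<close>)
qed

section \<open>An integrable radial weight\<close>

lemma integrable_inverse_one_plus_square: "integrable lborel (\<lambda>x::real. inverse (1 + x\<^sup>2))"
proof -
  have "set_integrable lborel (einterval (- \<infinity>) \<infinity>) (\<lambda>x::real. inverse (1 + x\<^sup>2))"
    by (rule interval_integral_FTC_nonneg[where F = arctan and A = "-pi/2" and B = "pi/2"])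
      (auto intro!: derivative_eq_intros continuous_intros
         simp: add_nonneg_eq_0_iff ereal_tendsto_simps
         intro: tendsto_arctan_at_top tendsto_arctan_at_bot)
  then show ?thesis by (simp add: set_integrable_def einterval_def)
qed

text \<open>The exponent 2 d fits the comparison 1 + (x.b)^2 \<le> (1 + |x|)^2 in each of the d
  coordinates, which makes the weight integrable. Being radially decreasing, it turns lower bounds
  on distances into upper bounds on packets.\<close>

abbreviation peak :: "'a::euclidean_space \<Rightarrow> real" where
  "peak x \<equiv> inverse ((1 + norm x) ^ (2 * DIM('a)))"

lemma integrable_peak: "integrable lborel (peak :: 'a::euclidean_space \<Rightarrow> real)"
proof (rule Bochner_Integration.integrable_bound)
  show "integrable lborel (\<lambda>x::'a. \<Prod>b\<in>Basis. inverse (1 + (x \<bullet> b)\<^sup>2))"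
    by (rule integrable_lborel_prod[where f = "\<lambda>_ y. inverse (1 + y\<^sup>2)"])
       (rule integrable_inverse_one_plus_square)
  have "(\<Prod>b\<in>(Basis::'a set). 1 + (x \<bullet> b)\<^sup>2) \<le> (1 + norm x) ^ (2 * DIM('a))" for x :: 'a
  proof -
    have "1 + (x \<bullet> b)\<^sup>2 \<le> (1 + norm x)\<^sup>2" if "b \<in> Basis" for b
    proof -
      have "(x \<bullet> b)\<^sup>2 \<le> (norm x)\<^sup>2"
        using Basis_le_norm[OF that, of x] by (metis abs_le_square_iff abs_norm_cancel)
      then show ?thesis by (simp add: power2_sum add_increasing2)
    qed
    then have "(\<Prod>b\<in>(Basis::'a set). 1 + (x \<bullet> b)\<^sup>2) \<le> (\<Prod>b\<in>(Basis::'a set). (1 + norm x)\<^sup>2)"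
      by (intro prod_mono) auto
    then show ?thesis by (simp add: power_mult)
  qed
  moreover have "0 < (\<Prod>b\<in>(Basis::'a set). 1 + (x \<bullet> b)\<^sup>2)" for x :: 'a
    by (intro prod_pos) (simp add: add_pos_nonneg)
  ultimately show "AE x in lborel. norm (peak (x::'a)) \<le> norm (\<Prod>b\<in>Basis. inverse (1 + (x \<bullet> b)\<^sup>2))"
    by (auto simp: prod_inversef[unfolded comp_def] abs_of_nonneg less_imp_le intro!: le_imp_inverse_le)
qed simp

section \<open>Decay of Fourier transforms of test functions\<close>

lemma integrable_compact_support:
  fixes f :: "'a::euclidean_space \<Rightarrow> 'b::{banach, second_countable_topology}"
  assumes "continuous_on UNIV f" "\<And>x. R < norm x \<Longrightarrow> f x = 0"
  shows "integrable lborel f"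
proof -
  have "integrable lborel (\<lambda>x. indicator (cball 0 R) x *\<^sub>R f x)"
    by (rule borel_integrable_compact) (use assms in \<open>auto intro: continuous_on_subset\<close>)
  also have "(\<lambda>x. indicator (cball 0 R) x *\<^sub>R f x) = f"
    using assms(2) by (auto simp: indicator_def not_le)
  finally show ?thesis .
qed

lemma bounded_compact_support:
  fixes f :: "'a::euclidean_space \<Rightarrow> 'b::real_normed_vector"
  assumes "continuous_on UNIV f" "\<And>x. R < norm x \<Longrightarrow> f x = 0"
  obtains C where "0 < C" "\<And>x. norm (f x) \<le> C"
proof -
  have "compact (f ` cball 0 R)"
    using assms(1) by (intro compact_continuous_image) (auto intro: continuous_on_subset)
  then obtain C where C: "0 < C" "\<And>y. y \<in> f ` cball 0 R \<Longrightarrow> norm y \<le> C"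
    using bounded_pos compact_imp_bounded by metis
  have "norm (f x) \<le> C" for x
    using C(2)[of "f x"] C(1) assms(2)[of x] by (cases "norm x \<le> R") auto
  then show ?thesis using C(1) that by blast
qed

lemma measurable_cis [measurable]: "cis \<in> borel_measurable borel"
  by (intro borel_measurable_continuous_onI continuous_intros)

lemma integrable_mult_cis:
  fixes f :: "'a::euclidean_space \<Rightarrow> complex"
  assumes "integrable lborel f" "g \<in> borel_measurable borel"
  shows "integrable lborel (\<lambda>x. f x * cis (g x))"
proof (rule Bochner_Integration.integrable_bound[OF assms(1)])
  have [measurable]: "f \<in> borel_measurable borel"
    using assms(1) by (rule borel_measurable_integrable_lborel)
  note assms(2)[measurable]
  show "(\<lambda>x. f x * cis (g x)) \<in> borel_measurable lborel" by simp
qed (simp add: norm_mult)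

lemma has_vector_derivative_imp_quotient_tendsto:
  assumes "(f has_vector_derivative d) (at 0)"
  shows "((\<lambda>t. (f t - f 0) /\<^sub>R t) \<longlongrightarrow> d) (at 0)"
proof (rule LIM_zero_cancel, rule tendsto_norm_zero_cancel)
  have "((\<lambda>t. norm (f t - f 0 - t *\<^sub>R d) / norm t) \<longlongrightarrow> 0) (at 0)"
    using assms by (simp add: has_vector_derivative_def has_derivative_at)
  then show "((\<lambda>t. norm ((f t - f 0) /\<^sub>R t - d)) \<longlongrightarrow> 0) (at 0)"
  proof (rule Lim_transform_eventually)
    have "norm (f t - f 0 - t *\<^sub>R d) / norm t = norm ((f t - f 0) /\<^sub>R t - d)" if "t \<noteq> 0" for t
    proof -
      have "(f t - f 0) /\<^sub>R t - d = (f t - f 0 - t *\<^sub>R d) /\<^sub>R t"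
        using that by (simp add: scaleR_diff_right)
      then show ?thesis by (simp add: divide_inverse mult.commute)
    qed
    then show "\<forall>\<^sub>F t in at 0. norm (f t - f 0 - t *\<^sub>R d) / norm t = norm ((f t - f 0) /\<^sub>R t - d)"
      by (auto simp: eventually_at_filter)
  qed
qed

text \<open>Translation of the integrand by \<open>h b\<close> multiplies the integral by \<open>cis (- h (x \<bullet> b))\<close>; the derivative
  in \<open>h\<close> of this identity replaces an integration by parts.\<close>

lemma fourier_derivative:
  fixes f f' :: "'a::euclidean_space \<Rightarrow> complex"
  assumes f: "\<And>x. (f has_derivative D x) (at x)" and f': "\<And>x. D x b = f' x"
    and cont: "continuous_on UNIV f'"
    and supp: "\<And>x. R < norm x \<Longrightarrow> f x = 0" "\<And>x. R < norm x \<Longrightarrow> f' x = 0"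
    and b: "b \<in> Basis"
  shows "(LINT \<xi>|lborel. f' \<xi> * cis (x \<bullet> \<xi>)) = - \<i> * complex_of_real (x \<bullet> b) * (LINT \<xi>|lborel. f \<xi> * cis (x \<bullet> \<xi>))"
proof -
  let ?I = "LINT \<xi>|lborel. f \<xi> * cis (x \<bullet> \<xi>)"
  define h :: "nat \<Rightarrow> real" where "h n = inverse (real (Suc n))" for n
  have h: "0 < h n" "h n \<le> 1" for n
    unfolding h_def by (auto simp: field_simps)
  have h0: "h \<longlonglongrightarrow> 0" unfolding h_def by (rule LIMSEQ_inverse_real_of_nat)
  have fc: "continuous_on UNIV f"
    using f has_derivative_continuous by (blast intro: continuous_at_imp_continuous_on)
  have meas[measurable]: "f \<in> borel_measurable borel" "f' \<in> borel_measurable borel"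
    using fc cont by (auto intro: borel_measurable_continuous_onI)
  obtain C where C: "0 < C" "\<And>x. norm (f' x) \<le> C"
    using bounded_compact_support[OF cont supp(2)] by metis
  define q where "q n \<xi> = (f (\<xi> + h n *\<^sub>R b) - f \<xi>) / complex_of_real (h n) * cis (x \<bullet> \<xi>)" for n \<xi>
  have vd: "((\<lambda>t. f (\<xi> + t *\<^sub>R b)) has_vector_derivative f' (\<xi> + t *\<^sub>R b)) (at t)" for \<xi> t
  proof -
    have "((\<lambda>t. f (\<xi> + t *\<^sub>R b)) has_derivative (\<lambda>s. D (\<xi> + t *\<^sub>R b) (s *\<^sub>R b))) (at t)"
      by (rule has_derivative_compose[OF _ f, of "\<lambda>t. \<xi> + t *\<^sub>R b", simplified])
        (auto intro!: derivative_eq_intros)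
    moreover have "D (\<xi> + t *\<^sub>R b) (s *\<^sub>R b) = s *\<^sub>R f' (\<xi> + t *\<^sub>R b)" for s
      using f' linear_scale[OF has_derivative_linear[OF f]] by metis
    ultimately show ?thesis by (simp add: has_vector_derivative_def)
  qed
  have qlim: "(\<lambda>n. q n \<xi>) \<longlonglongrightarrow> f' \<xi> * cis (x \<bullet> \<xi>)" for \<xi>
  proof -
    have "((\<lambda>t. (f (\<xi> + t *\<^sub>R b) - f \<xi>) /\<^sub>R t) \<longlongrightarrow> f' \<xi>) (at 0)"
      using has_vector_derivative_imp_quotient_tendsto[of "\<lambda>t. f (\<xi> + t *\<^sub>R b)"] vd[of \<xi> 0] by simp
    then have "(\<lambda>n. (f (\<xi> + h n *\<^sub>R b) - f \<xi>) /\<^sub>R h n) \<longlonglongrightarrow> f' \<xi>"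
      using h0 h(1) by (auto elim!: filterlim_compose simp: filterlim_at less_imp_neq[THEN not_sym])
    then show ?thesis
      unfolding q_def by (intro tendsto_mult tendsto_const) (simp add: scaleR_conv_of_real divide_inverse mult.commute)
  qed
  \<comment> \<open>The mean value inequality bounds the difference quotients by \<open>C\<close>
    uniformly in \<open>n\<close>. Since \<open>h n\<close> is at most 1, they all vanish outside
    the ball of radius R + 1, which gives a single integrable majorant.\<close>
  have qbd: "norm (q n \<xi>) \<le> C * indicator (cball 0 (R + 1)) \<xi>" for n \<xi>
  proof (cases "norm \<xi> \<le> R + 1")
    case True
    have "norm (f (\<xi> + h n *\<^sub>R b) - f (\<xi> + 0 *\<^sub>R b)) \<le> C * norm (h n - 0)"
      by (rule differentiable_bound[where S = UNIV and f' = "\<lambda>t s. s *\<^sub>R f' (\<xi> + t *\<^sub>R b)"])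
         (use vd C(2) in \<open>auto simp: has_vector_derivative_def intro!: onorm_le simp: mult.commute[of "\<bar>_\<bar>"] mult_right_mono\<close>)
    moreover have "norm (q n \<xi>) = norm (f (\<xi> + h n *\<^sub>R b) - f \<xi>) / h n"
      using h(1)[of n] by (simp add: q_def norm_mult norm_divide)
    ultimately show ?thesis using True h(1)[of n]
      by (simp add: divide_le_eq)
  next
    case False
    have "norm \<xi> \<le> norm (\<xi> + h n *\<^sub>R b) + norm (h n *\<^sub>R b)"
      by (metis add_diff_cancel norm_triangle_sub norm_minus_commute norm_triangle_ineq4)
    then have "R < norm (\<xi> + h n *\<^sub>R b)" using False h[of n] b by simp
    then show ?thesis using supp(1) False by (auto simp: q_def)
  qed
  have fi: "integrable lborel f" by (rule integrable_compact_support[OF fc supp(1)])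
  have int1: "integrable lborel (\<lambda>\<xi>. f \<xi> * cis (x \<bullet> \<xi>))"
    by (rule integrable_mult_cis[OF fi]) simp
  have int2: "integrable lborel (\<lambda>\<xi>. f (\<xi> + h n *\<^sub>R b) * cis (x \<bullet> \<xi>))" for n
    by (rule integrable_mult_cis) (use fi integrable_lborel_translate[of f "h n *\<^sub>R b"] in \<open>simp_all add: add.commute\<close>)
  have tr: "(LINT \<xi>|lborel. f (\<xi> + h n *\<^sub>R b) * cis (x \<bullet> \<xi>)) = cis (- (h n * (x \<bullet> b))) * ?I" for n
  proof -
    have "(LINT \<xi>|lborel. f (\<xi> + h n *\<^sub>R b) * cis (x \<bullet> \<xi>)) =
        (LINT \<xi>|lborel. cis (- (h n * (x \<bullet> b))) * (f (h n *\<^sub>R b + \<xi>) * cis (x \<bullet> (h n *\<^sub>R b + \<xi>))))"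
      by (intro Bochner_Integration.integral_cong) (auto simp: inner_add_right cis_mult add.commute mult.left_commute)
    also have "\<dots> = cis (- (h n * (x \<bullet> b))) * (LINT \<xi>|lborel. f (h n *\<^sub>R b + \<xi>) * cis (x \<bullet> (h n *\<^sub>R b + \<xi>)))"
      by (rule integral_mult_right_zero)
    finally show ?thesis
      by (simp add: integral_lborel_translate[of "\<lambda>\<xi>. f \<xi> * cis (x \<bullet> \<xi>)"])
  qed
  have qint: "integral\<^sup>L lborel (q n) = (cis (- (h n * (x \<bullet> b))) - 1) / complex_of_real (h n) * ?I" for n
  proof -
    have "q n = (\<lambda>\<xi>. inverse (complex_of_real (h n)) * (f (\<xi> + h n *\<^sub>R b) * cis (x \<bullet> \<xi>) - f \<xi> * cis (x \<bullet> \<xi>)))"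
      unfolding q_def by (auto simp: divide_inverse algebra_simps)
    then have "integral\<^sup>L lborel (q n) = inverse (complex_of_real (h n)) *
        ((LINT \<xi>|lborel. f (\<xi> + h n *\<^sub>R b) * cis (x \<bullet> \<xi>)) - ?I)"
      using int1 int2 by simp
    then show ?thesis unfolding tr by (simp add: divide_inverse algebra_simps)
  qed
  have "(\<lambda>n. integral\<^sup>L lborel (q n)) \<longlonglongrightarrow> (LINT \<xi>|lborel. f' \<xi> * cis (x \<bullet> \<xi>))"
  proof (rule integral_dominated_convergence)
    show "integrable lborel (\<lambda>\<xi>. C * indicator (cball 0 (R + 1)) (\<xi>::'a) :: real)"
      by (intro integrable_mult_right integrable_real_indicator) (auto simp: emeasure_lborel_cball_finite[unfolded infinity_ennreal_def])
    show "q n \<in> borel_measurable lborel" for n unfolding q_def by simp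
  qed (use qlim qbd in auto)
  moreover have "(\<lambda>n. (cis (- (h n * (x \<bullet> b))) - 1) / complex_of_real (h n) * ?I) \<longlonglongrightarrow>
      (- \<i> * complex_of_real (x \<bullet> b)) * ?I"
  proof (intro tendsto_mult tendsto_const)
    have "((\<lambda>t. cis (- (t * (x \<bullet> b)))) has_vector_derivative (- \<i> * complex_of_real (x \<bullet> b))) (at 0)"
      unfolding has_vector_derivative_def
      by (auto intro!: derivative_eq_intros simp: scaleR_conv_of_real)
    then have "((\<lambda>t. (cis (- (t * (x \<bullet> b))) - 1) /\<^sub>R t) \<longlongrightarrow> - \<i> * complex_of_real (x \<bullet> b)) (at 0)"
      using has_vector_derivative_imp_quotient_tendsto[of "\<lambda>t. cis (- (t * (x \<bullet> b)))"] by simp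
    then have "(\<lambda>n. (cis (- (h n * (x \<bullet> b))) - 1) /\<^sub>R h n) \<longlonglongrightarrow> - \<i> * complex_of_real (x \<bullet> b)"
      using h0 h(1) by (auto elim!: filterlim_compose simp: filterlim_at less_imp_neq[THEN not_sym])
    then show "(\<lambda>n. (cis (- (h n * (x \<bullet> b))) - 1) / complex_of_real (h n)) \<longlonglongrightarrow> - \<i> * complex_of_real (x \<bullet> b)"
      by (simp add: scaleR_conv_of_real divide_inverse mult.commute)
  qed
  ultimately show ?thesis unfolding qint using LIMSEQ_unique by blast
qed

section \<open>Iterated derivatives and rapid decay\<close>

lemma partial_derivs_Cons:
  "partial_derivs (b # bs) f x = frechet_derivative (partial_derivs bs f) (at x) b"
  by (simp add: partial_derivs_def)

lemma partial_derivs_Nil [simp]: "partial_derivs [] f = f"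
  by (simp add: partial_derivs_def)

lemma smooth_partial_derivs_has_derivative:
  assumes "smooth f" "set bs \<subseteq> Basis"
  shows "(partial_derivs bs f has_derivative frechet_derivative (partial_derivs bs f) (at x)) (at x)"
  using assms frechet_derivative_works unfolding smooth_def by blast

lemma smooth_continuous_on_partial_derivs:
  assumes "smooth f" "set bs \<subseteq> Basis"
  shows "continuous_on S (partial_derivs bs f)"
  using smooth_partial_derivs_has_derivative[OF assms] has_derivative_continuous
  by (blast intro: continuous_at_imp_continuous_on)

lemma smooth_continuous_on: "smooth f \<Longrightarrow> continuous_on S f"
  using smooth_continuous_on_partial_derivs[of f "[]"] by simp

text \<open>The strict inequality makes the region open, so vanishing there passes to
  derivatives.\<close>

lemma partial_derivs_compact_support:
  assumes "\<And>x. R < norm x \<Longrightarrow> f x = 0" "R < norm x"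
  shows "partial_derivs bs f x = 0"
  using assms(2)
proof (induction bs arbitrary: x)
  case Nil
  then show ?case using assms(1) by simp
next
  case (Cons b bs)
  have "open {y::'a. R < norm y}"
    by (intro open_Collect_less continuous_intros)
  then have "(partial_derivs bs f has_derivative (\<lambda>_. 0)) (at x)"
    by (rule has_derivative_transform_within_open[OF has_derivative_const[of 0]]) (use Cons in auto)
  then show ?case
    by (simp add: partial_derivs_Cons flip: frechet_derivative_at)
qed

lemma fourier_partial_derivs:
  fixes f :: "'a::euclidean_space \<Rightarrow> complex"
  assumes f: "smooth f" "\<And>x. R < norm x \<Longrightarrow> f x = 0" and b: "b \<in> Basis"
  shows "(LINT \<xi>|lborel. partial_derivs (replicate n b) f \<xi> * cis (x \<bullet> \<xi>)) =
    (- \<i> * complex_of_real (x \<bullet> b)) ^ n * (LINT \<xi>|lborel. f \<xi> * cis (x \<bullet> \<xi>))"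
proof (induction n)
  case (Suc n)
  have s: "set (replicate m b) \<subseteq> Basis" for m using b by auto
  have "(LINT \<xi>|lborel. partial_derivs (b # replicate n b) f \<xi> * cis (x \<bullet> \<xi>)) =
    - \<i> * complex_of_real (x \<bullet> b) * (LINT \<xi>|lborel. partial_derivs (replicate n b) f \<xi> * cis (x \<bullet> \<xi>))"
  proof (rule fourier_derivative[where R = R and D = "\<lambda>x. frechet_derivative (partial_derivs (replicate n b) f) (at x)"])
    show "continuous_on UNIV (partial_derivs (b # replicate n b) f)"
      using smooth_continuous_on_partial_derivs[OF f(1) s[of "Suc n"]] by simp
    show "R < norm x \<Longrightarrow> partial_derivs (b # replicate n b) f x = 0" for x
      by (rule partial_derivs_compact_support[OF f(2)])
    show "R < norm x \<Longrightarrow> partial_derivs (replicate n b) f x = 0" for x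
      by (rule partial_derivs_compact_support[OF f(2)])
    show "frechet_derivative (partial_derivs (replicate n b) f) (at x) b = partial_derivs (b # replicate n b) f x" for x
      by (simp add: partial_derivs_Cons)
  qed (rule smooth_partial_derivs_has_derivative[OF f(1) s] b)+
  then show ?case using Suc by simp
qed simp

text \<open>Pure derivatives suffice: \<open>n\<close> derivatives in direction \<open>b\<close>
  produce the factor |x.b|^n, and the largest coordinate of \<open>x\<close> controls |x| up to the
  factor d.\<close>

lemma inv_fourier_decay:
  fixes f :: "'a::euclidean_space \<Rightarrow> complex"
  assumes "test_function f"
  obtains C where "0 < C" "\<And>x. norm (inv_fourier f x) \<le> C * inverse ((1 + norm x) ^ n)"
proof -
  obtain R where f: "smooth f" "\<And>x. R < norm x \<Longrightarrow> f x = 0"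
    using assms unfolding test_function_def by blast
  define I where "I x = (LINT \<xi>|lborel. f \<xi> * cis (x \<bullet> \<xi>))" for x
  define A where "A b = (LINT \<xi>|lborel. norm (partial_derivs (replicate n b) f \<xi>))" for b
  define A0 where "A0 = (LINT \<xi>|lborel. norm (f \<xi>))"
  have A: "\<bar>x \<bullet> b\<bar> ^ n * norm (I x) \<le> A b" if "b \<in> Basis" for b x
  proof -
    have "\<bar>x \<bullet> b\<bar> ^ n * norm (I x) = norm (LINT \<xi>|lborel. partial_derivs (replicate n b) f \<xi> * cis (x \<bullet> \<xi>))"
      using fourier_partial_derivs[OF f that, where x = x and n = n] by (simp add: I_def norm_mult norm_power)
    also have "\<dots> \<le> (LINT \<xi>|lborel. norm (partial_derivs (replicate n b) f \<xi> * cis (x \<bullet> \<xi>)))"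
      by (rule integral_norm_bound)
    finally show ?thesis by (simp add: A_def norm_mult)
  qed
  have A0: "norm (I x) \<le> A0" for x
    using integral_norm_bound[of lborel "\<lambda>\<xi>. f \<xi> * cis (x \<bullet> \<xi>)"] by (simp add: I_def A0_def norm_mult)
  have nn: "0 \<le> A b" "0 \<le> A0" for b unfolding A_def A0_def by auto
  define d where "d = real DIM('a)"
  have d: "1 \<le> d" using DIM_positive[where 'a='a] unfolding d_def by linarith
  define S where "S = A0 + (\<Sum>b\<in>Basis. A b)"
  have S: "A0 \<le> S" "\<And>b. b \<in> Basis \<Longrightarrow> A b \<le> S" "0 \<le> S"
    unfolding S_def using nn by (auto intro!: add_increasing member_le_sum sum_nonneg)
  have bd: "(1 + norm x) ^ n * norm (I x) \<le> (2 * d) ^ n * S" for x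
  proof (cases "norm x \<le> 1")
    case True
    have "(1 + norm x) ^ n \<le> (2 * d) ^ n" using True d by (intro power_mono) auto
    then show ?thesis using A0[of x] S d by (intro mult_mono) auto
  next
    case False
    \<comment> \<open>\<open>b\<close> is the direction of the largest coordinate. For |x| > 1 this
      gives 1 + |x| \<le> 2 |x| \<le> 2 d |x.b|, the origin of the base 2 d.\<close>
    obtain b where b: "b \<in> Basis" and m: "\<And>c. c \<in> Basis \<Longrightarrow> \<bar>x \<bullet> c\<bar> \<le> \<bar>x \<bullet> b\<bar>"
      using Max_in[of "(\<lambda>c. \<bar>x \<bullet> c\<bar>) ` Basis"] Max_ge[of "(\<lambda>c. \<bar>x \<bullet> c\<bar>) ` Basis"]
      by (auto simp del: Max_in Max_ge)
    have "norm x \<le> (\<Sum>c\<in>Basis. \<bar>x \<bullet> c\<bar>)" by (rule norm_le_l1)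
    also have "\<dots> \<le> d * \<bar>x \<bullet> b\<bar>" unfolding d_def by (rule sum_bounded_above[OF m])
    finally have "1 + norm x \<le> (2 * d) * \<bar>x \<bullet> b\<bar>" using False by simp
    then have "(1 + norm x) ^ n * norm (I x) \<le> ((2 * d) * \<bar>x \<bullet> b\<bar>) ^ n * norm (I x)"
      by (intro mult_right_mono power_mono) auto
    also have "\<dots> = (2 * d) ^ n * (\<bar>x \<bullet> b\<bar> ^ n * norm (I x))" by (simp add: power_mult_distrib)
    also have "\<dots> \<le> (2 * d) ^ n * S"
      using A[OF b, of x] S(2)[OF b] d by (intro mult_left_mono) auto
    finally show ?thesis .
  qed
  define P where "P = ((2 * pi) ^ DIM('a) :: real)"
  have P: "0 < P" unfolding P_def by simp
  have eq: "norm (inv_fourier f x) = norm (I x) / P" for x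
    unfolding inv_fourier_def I_def P_def[symmetric] norm_divide norm_of_real using P by simp
  show ?thesis
  proof (rule that[of "(2 * d) ^ n * (S + 1) / P"])
    show "0 < (2 * d) ^ n * (S + 1) / P" using d S(3) P by simp
    show "norm (inv_fourier f x) \<le> (2 * d) ^ n * (S + 1) / P * inverse ((1 + norm x) ^ n)" for x
    proof -
      have "0 < (1 + norm x) ^ n" by (simp add: add_pos_nonneg)
      moreover have "(1 + norm x) ^ n * norm (I x) \<le> (2 * d) ^ n * (S + 1)"
        using bd[of x] d by (simp add: distrib_left add_increasing2)
      ultimately show ?thesis unfolding eq using P by (simp add: field_simps)
    qed
  qed
qed

section \<open>Continuity and integrability of inverse Fourier transforms\<close>

lemma continuous_inv_fourier:
  fixes f :: "'a::euclidean_space \<Rightarrow> complex"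
  assumes f: "integrable lborel f"
  shows "continuous_on S (inv_fourier f)"
proof -
  have [measurable]: "f \<in> borel_measurable borel"
    using f by (rule borel_measurable_integrable_lborel)
  have "isCont (\<lambda>x. LINT \<xi>|lborel. f \<xi> * cis (x \<bullet> \<xi>)) x" for x
    unfolding continuous_at_sequentially comp_def
  proof (intro allI impI)
    fix y :: "nat \<Rightarrow> 'a" assume "y \<longlonglongrightarrow> x"
    then show "(\<lambda>n. LINT \<xi>|lborel. f \<xi> * cis (y n \<bullet> \<xi>)) \<longlonglongrightarrow> (LINT \<xi>|lborel. f \<xi> * cis (x \<bullet> \<xi>))"
      by (intro integral_dominated_convergence[where w = "\<lambda>\<xi>. norm (f \<xi>)"])
        (auto simp: norm_mult f intro!: tendsto_intros)
  qed
  then show ?thesis unfolding inv_fourier_def[abs_def]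
    by (auto intro!: continuous_intros continuous_at_imp_continuous_on)
qed

lemma measurable_inv_fourier [measurable]:
  fixes f :: "'a::euclidean_space \<Rightarrow> complex"
  shows "integrable lborel f \<Longrightarrow> inv_fourier f \<in> borel_measurable borel"
  by (intro borel_measurable_continuous_onI continuous_inv_fourier)

lemma test_functionE:
  assumes "test_function f"
  obtains R where "0 < R" "\<And>x. R < norm x \<Longrightarrow> f x = 0" "continuous_on UNIV f" "integrable lborel f"
proof -
  obtain R where R: "\<And>x. R < norm x \<Longrightarrow> f x = 0"
    using assms unfolding test_function_def by blast
  have c: "continuous_on UNIV f"
    using assms smooth_continuous_on unfolding test_function_def by blast
  show ?thesis
    by (rule that[of "max R 1"]) (use R c integrable_compact_support[OF c R] in auto)
qed

lemma integrable_inv_fourier_test_function: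
  fixes f :: "'a::euclidean_space \<Rightarrow> complex"
  assumes "test_function f"
  shows "integrable lborel (inv_fourier f)"
proof -
  obtain C where C: "0 < C" "\<And>x. norm (inv_fourier f x) \<le> C * peak x"
    using inv_fourier_decay[OF assms] by blast
  obtain R where "integrable lborel f" using test_functionE[OF assms] by blast
  then have "inv_fourier f \<in> borel_measurable lborel" by simp
  then show ?thesis
    using C by (intro Bochner_Integration.integrable_bound[OF integrable_mult_right[OF integrable_peak, of C]])
      (auto simp: abs_of_pos intro: order_trans)
qed

section \<open>Fourier inversion\<close>

text \<open>The product form reduces the mass and the Fourier transform to known facts about the
  normal distribution on the line; \<open>gauss_eq\<close> recovers the radial form.\<close>

definition gauss :: "'a::euclidean_space \<Rightarrow> real" where
  "gauss y = (\<Prod>b\<in>Basis. std_normal_density (y \<bullet> b))"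

lemma gauss_eq: "gauss (y::'a::euclidean_space) = exp (- (norm y)\<^sup>2 / 2) / sqrt (2 * pi) ^ DIM('a)"
proof -
  have "gauss y = (\<Prod>b\<in>(Basis::'a set). exp (- (y \<bullet> b)\<^sup>2 / 2) / sqrt (2 * pi))"
    unfolding gauss_def by (intro prod.cong) (auto simp: normal_density_def)
  also have "\<dots> = exp (\<Sum>b\<in>(Basis::'a set). - (y \<bullet> b)\<^sup>2 / 2) / sqrt (2 * pi) ^ DIM('a)"
    by (simp add: prod_dividef exp_sum)
  also have "(\<Sum>b\<in>(Basis::'a set). - (y \<bullet> b)\<^sup>2 / 2) = - (norm y)\<^sup>2 / 2"
    unfolding power2_norm_eq_inner
    by (subst euclidean_inner[of y y]) (simp add: sum_divide_distrib[symmetric] sum_negf power2_eq_square)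
  finally show ?thesis .
qed

lemma gauss_pos: "0 < gauss y"
  unfolding gauss_eq by simp

lemma continuous_gauss: "continuous_on S gauss"
  unfolding gauss_eq[abs_def] by (intro continuous_intros) auto

lemma measurable_gauss [measurable]: "gauss \<in> borel_measurable borel"
  by (intro borel_measurable_continuous_onI continuous_gauss)

lemma integrable_gauss: "integrable lborel (gauss :: 'a::euclidean_space \<Rightarrow> real)"
  unfolding gauss_def[abs_def]
  by (rule integrable_lborel_prod[where f = "\<lambda>_. std_normal_density"]) simp

lemma integral_gauss: "(LINT y|lborel. gauss (y::'a::euclidean_space)) = 1"
  unfolding gauss_def
  by (subst integral_lborel_prod[where f = "\<lambda>_. std_normal_density"]) auto

text \<open>Each coordinate contributes the characteristic function of the standard normal
  distribution. The factor sqrt (2 pi) per coordinate restores the normalization of the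
  density.\<close>

lemma fourier_gauss:
  fixes z :: "'a::euclidean_space"
  shows "(LINT y|lborel. complex_of_real (gauss y) * cis (y \<bullet> z)) = complex_of_real (sqrt (2 * pi) ^ DIM('a) * gauss z)"
proof -
  have c: "(LINT x|lborel. complex_of_real (std_normal_density x) * cis (x * t)) = complex_of_real (exp (- t\<^sup>2 / 2))" for t
  proof -
    have "(LINT x|lborel. complex_of_real (std_normal_density x) * cis (x * t)) =
      (LINT x|lborel. std_normal_density x *\<^sub>R iexp (t * x))"
      by (simp add: scaleR_conv_of_real cis_conv_exp mult.commute)
    also have "\<dots> = char std_normal_distribution t"
      unfolding char_def by (subst integral_density) auto
    finally show ?thesis by (simp add: char_std_normal_distribution)
  qed
  have cs: "cis (y \<bullet> z) = (\<Prod>b\<in>Basis. cis ((y \<bullet> b) * (z \<bullet> b)))" for y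
    by (simp add: euclidean_inner[of y z] cis_conv_exp exp_sum[symmetric] sum_distrib_left)
  have "(LINT y|lborel. complex_of_real (gauss y) * cis (y \<bullet> z)) =
     (LINT y|lborel. (\<Prod>b\<in>(Basis::'a set). complex_of_real (std_normal_density (y \<bullet> b)) * cis ((y \<bullet> b) * (z \<bullet> b))))"
    by (simp add: gauss_def cs prod.distrib)
  also have "\<dots> = (\<Prod>b\<in>(Basis::'a set). LINT x|lborel. complex_of_real (std_normal_density x) * cis (x * (z \<bullet> b)))"
  proof (rule integral_lborel_prod[where f = "\<lambda>b x. complex_of_real (std_normal_density x) * cis (x * (z \<bullet> b))"])
    fix b :: 'a
    show "integrable lborel (\<lambda>x. complex_of_real (std_normal_density x) * cis (x * (z \<bullet> b)))"
      by (rule integrable_mult_cis) auto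
  qed
  also have "\<dots> = complex_of_real (\<Prod>b\<in>(Basis::'a set). sqrt (2 * pi) * std_normal_density (z \<bullet> b))"
    unfolding c of_real_prod by (intro prod.cong) (auto simp: normal_density_def)
  finally show ?thesis by (simp add: prod.distrib gauss_def)
qed


section \<open>Exchange of integrals, convolution theorem and inversion\<close>

lemma integrable_fst_mult_snd:
  fixes f :: "'a::euclidean_space \<Rightarrow> real" and g :: "'b::euclidean_space \<Rightarrow> real"
  assumes "integrable lborel f" "integrable lborel g"
  shows "integrable (lborel \<Otimes>\<^sub>M lborel) (\<lambda>(x, y). f x * g y)"
proof (rule lborel_pair.Fubini_integrable)
  have [measurable]: "f \<in> borel_measurable borel" "g \<in> borel_measurable borel"
    using assms borel_measurable_integrable_lborel by blast+
  show "(\<lambda>(x, y). f x * g y) \<in> borel_measurable (lborel \<Otimes>\<^sub>M lborel)"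
    by simp
  show "integrable lborel (\<lambda>x. LINT y|lborel. norm (case (x, y) of (x, y) \<Rightarrow> f x * g y))"
    using assms by (simp add: abs_mult)
qed (use assms in simp)

text \<open>A majorant that separates the variables is integrable on the product space, so Fubini
  applies. The second conclusion is what later allows real parts and inequalities to pass through
  the outer integral.\<close>

lemma
  fixes F :: "'a::euclidean_space \<Rightarrow> 'b::euclidean_space \<Rightarrow> complex"
  assumes F: "(\<lambda>(x, y). F x y) \<in> borel_measurable (borel \<Otimes>\<^sub>M borel)"
    and int: "integrable lborel f" "integrable lborel g"
    and bound: "\<And>x y. norm (F x y) \<le> f x * g y"
  shows integral_swap_dominated: "(LINT x|lborel. LINT y|lborel. F x y) = (LINT y|lborel. LINT x|lborel. F x y)"
    and integrable_integral_dominated: "integrable lborel (\<lambda>x. LINT y|lborel. F x y)"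
proof -
  have [measurable]: "f \<in> borel_measurable borel" "g \<in> borel_measurable borel"
    using int borel_measurable_integrable_lborel by blast+
  note F[measurable]
  have "integrable (lborel \<Otimes>\<^sub>M lborel) (\<lambda>(x, y). F x y)"
    by (rule Bochner_Integration.integrable_bound[OF integrable_fst_mult_snd[OF int]])
      (use F order_trans[OF bound abs_ge_self] in \<open>simp_all add: split_beta\<close>)
  then show "(LINT x|lborel. LINT y|lborel. F x y) = (LINT y|lborel. LINT x|lborel. F x y)"
    and "integrable lborel (\<lambda>x. LINT y|lborel. F x y)"
    using lborel_pair.Fubini_integral[of F] lborel_pair.integrable_fst[of F] by simp_all
qed

text \<open>The whole factor (2 pi)^(-d) sits in \<open>inv_fourier\<close>, so the inversion
  theorem carries no constant.\<close>

definition fourier :: "('a::euclidean_space \<Rightarrow> complex) \<Rightarrow> 'a \<Rightarrow> complex" where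
  "fourier U \<xi> = (LINT y|lborel. U y * cis (- (y \<bullet> \<xi>)))"

text \<open>The convolution theorem, by Fubini. Integrability of \<open>p\<close> is enough, so
  \<open>p\<close> may be a test function times a symbol that is not smooth at 0.\<close>

lemma integral_mult_inv_fourier:
  fixes U p :: "'a::euclidean_space \<Rightarrow> complex"
  assumes U: "integrable lborel U" and p: "integrable lborel p"
  shows "(LINT y|lborel. U y * inv_fourier p (x - y)) = inv_fourier (\<lambda>\<xi>. p \<xi> * fourier U \<xi>) x"
proof -
  have [measurable]: "U \<in> borel_measurable borel" "p \<in> borel_measurable borel"
    using U p borel_measurable_integrable_lborel by blast+
  let ?F = "\<lambda>y \<xi>. U y * (p \<xi> * cis ((x - y) \<bullet> \<xi>))"
  have eq: "?F y \<xi> = (p \<xi> * cis (x \<bullet> \<xi>)) * (U y * cis (- (y \<bullet> \<xi>)))" for y \<xi>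
  proof -
    have "cis ((x - y) \<bullet> \<xi>) = cis (x \<bullet> \<xi>) * cis (- (y \<bullet> \<xi>))"
      by (simp add: inner_diff_left cis_mult)
    then show ?thesis by (simp only: mult_ac)
  qed
  have "(LINT y|lborel. LINT \<xi>|lborel. ?F y \<xi>) = (LINT \<xi>|lborel. LINT y|lborel. ?F y \<xi>)"
  proof (rule integral_swap_dominated)
    show "integrable lborel (\<lambda>y. norm (U y))" "integrable lborel (\<lambda>\<xi>. norm (p \<xi>))"
      using U p by simp_all
  qed (auto simp: norm_mult)
  also have "\<dots> = (LINT \<xi>|lborel. (p \<xi> * cis (x \<bullet> \<xi>)) * fourier U \<xi>)"
    unfolding eq integral_mult_right_zero fourier_def ..
  also have "\<dots> = (LINT \<xi>|lborel. (p \<xi> * fourier U \<xi>) * cis (x \<bullet> \<xi>))"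
    by (simp only: mult_ac)
  finally have "(LINT y|lborel. U y * (LINT \<xi>|lborel. p \<xi> * cis ((x - y) \<bullet> \<xi>))) = \<dots>"
    by simp
  then show ?thesis by (simp add: inv_fourier_def)
qed

text \<open>Gaussian summation: \<open>J n\<close> is the integral defining the transform with the
  extra factor \<open>gauss (h n *\<^sub>R y)\<close>, and it is evaluated in two ways. The order
  "transform after inverse transform" is the one needed for functions prescribed by their
  spectrum.\<close>

theorem fourier_inversion:
  fixes w :: "'a::euclidean_space \<Rightarrow> complex"
  assumes w: "continuous_on UNIV w" "\<And>\<xi>. R < norm \<xi> \<Longrightarrow> w \<xi> = 0"
    and U: "integrable lborel (inv_fourier w)"
  shows "fourier (inv_fourier w) \<xi> = w \<xi>"
proof -
  define h :: "nat \<Rightarrow> real" where "h n = inverse (real (Suc n))" for n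
  have h: "0 < h n" for n unfolding h_def by (auto simp: field_simps)
  have h0: "h \<longlonglongrightarrow> 0" unfolding h_def by (rule LIMSEQ_inverse_real_of_nat)
  define Q where "Q = sqrt (2 * pi) ^ DIM('a)"
  have Q: "0 < Q" unfolding Q_def by simp
  \<comment> \<open>The constant splits into two factors \<open>Q\<close>: one is the inverse of
    \<open>gauss 0\<close>, the other is produced by transforming the Gaussian.\<close>
  have P: "(2 * pi) ^ DIM('a) = Q\<^sup>2" 
  proof -
    have "Q\<^sup>2 = ((sqrt (2 * pi))\<^sup>2) ^ DIM('a)"
      unfolding Q_def by (simp only: power_mult[symmetric] mult.commute)
    then show ?thesis by simp
  qed
  have wi: "integrable lborel w" by (rule integrable_compact_support[OF w])
  obtain C where C: "0 < C" "\<And>x. norm (w x) \<le> C" using bounded_compact_support[OF w] by metis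
  have [measurable]: "w \<in> borel_measurable borel" "inv_fourier w \<in> borel_measurable borel"
    using w(1) wi by (auto intro: borel_measurable_continuous_onI)
  have g0: "gauss (y::'a) \<le> inverse Q" for y
  proof -
    have "exp (- (norm y)\<^sup>2 / 2) / Q \<le> 1 / Q"
      using Q by (intro divide_right_mono) auto
    then show ?thesis by (simp add: gauss_eq Q_def inverse_eq_divide)
  qed
  have gr: "integrable lborel (\<lambda>y. gauss (h n *\<^sub>R (y::'a)))" for n
    using integrable_lborel_affine[OF _ integrable_gauss, of "h n" 0] h[of n] by simp
  define J where "J n = (LINT y|lborel. inv_fourier w y * cis (- (y \<bullet> \<xi>)) * gauss (h n *\<^sub>R y))" for n
  have "J \<longlonglongrightarrow> (LINT y|lborel. inv_fourier w y * cis (- (y \<bullet> \<xi>)) * inverse Q)"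
    unfolding J_def
  proof (rule integral_dominated_convergence[where w = "\<lambda>y. norm (inv_fourier w y) * inverse Q"])
    have "(\<lambda>n. gauss (h n *\<^sub>R y)) \<longlonglongrightarrow> gauss (0::'a)" for y :: 'a
    proof -
      have "isCont gauss (0::'a)" using continuous_gauss[of "UNIV :: 'a set"] by (simp add: continuous_on_eq_continuous_at)
      then show ?thesis by (rule isCont_tendsto_compose) (use tendsto_scaleR[OF h0 tendsto_const, of y] in simp)
    qed
    then show "AE y in lborel. (\<lambda>n. inv_fourier w y * cis (- (y \<bullet> \<xi>)) * gauss (h n *\<^sub>R y)) \<longlonglongrightarrow>
        inv_fourier w y * cis (- (y \<bullet> \<xi>)) * inverse Q"
      by (intro AE_I2 tendsto_intros) (simp add: gauss_eq Q_def inverse_eq_divide)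
    show "AE y in lborel. norm (inv_fourier w y * cis (- (y \<bullet> \<xi>)) * gauss (h n *\<^sub>R y)) \<le> norm (inv_fourier w y) * inverse Q" for n
      using g0 by (auto simp: norm_mult abs_of_pos gauss_pos intro!: mult_left_mono)
  qed (use U in simp_all)
  then have 1: "J \<longlonglongrightarrow> inverse Q * fourier (inv_fourier w) \<xi>"
    by (simp add: fourier_def mult.commute)
  \<comment> \<open>After Fubini the Gaussian is transformed into a Gaussian of width
    \<open>h n\<close> about \<xi>, so \<open>J n\<close> is a local average of \<open>w\<close>.
    Continuity of \<open>w\<close> then gives the limit.\<close>
  have J: "J n = inverse Q * (LINT z|lborel. w (\<xi> + h n *\<^sub>R z) * gauss z)" for n
  proof -
    let ?F = "\<lambda>y \<eta>. w \<eta> * (gauss (h n *\<^sub>R y) * cis (y \<bullet> (\<eta> - \<xi>)))"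
    have "J n * complex_of_real (Q\<^sup>2) = (LINT y|lborel. LINT \<eta>|lborel. ?F y \<eta>)"
    proof -
      have "inv_fourier w y * cis (- (y \<bullet> \<xi>)) * gauss (h n *\<^sub>R y) * complex_of_real (Q\<^sup>2) = (LINT \<eta>|lborel. ?F y \<eta>)" for y
      proof -
        have eq: "?F y \<eta> = (cis (- (y \<bullet> \<xi>)) * gauss (h n *\<^sub>R y)) * (w \<eta> * cis (y \<bullet> \<eta>))" for \<eta>
        proof -
          have "cis (y \<bullet> (\<eta> - \<xi>)) = cis (- (y \<bullet> \<xi>)) * cis (y \<bullet> \<eta>)"
            by (simp add: inner_diff_right cis_mult)
          then show ?thesis by (simp only: mult_ac)
        qed
        have "(LINT \<eta>|lborel. ?F y \<eta>) = (cis (- (y \<bullet> \<xi>)) * gauss (h n *\<^sub>R y)) * (LINT \<eta>|lborel. w \<eta> * cis (y \<bullet> \<eta>))"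
          unfolding eq integral_mult_right_zero ..
        then show ?thesis using Q unfolding inv_fourier_def P by simp
      qed
      then show ?thesis unfolding J_def by (simp flip: integral_mult_left_zero)
    qed
    also have "\<dots> = (LINT \<eta>|lborel. LINT y|lborel. ?F y \<eta>)"
    proof (rule integral_swap_dominated)
      show "integrable lborel (\<lambda>y. gauss (h n *\<^sub>R (y::'a)))" "integrable lborel (\<lambda>\<xi>. norm (w \<xi>))"
        using gr wi by simp_all
    qed (auto simp: norm_mult gauss_pos abs_of_pos mult.commute)
    also have "\<dots> = (LINT \<eta>|lborel. w \<eta> * (Q / h n ^ DIM('a) * gauss ((\<eta> - \<xi>) /\<^sub>R h n)))"
    proof (rule Bochner_Integration.integral_cong[OF refl])
      fix \<eta>
      have "complex_of_real (Q * gauss ((\<eta> - \<xi>) /\<^sub>R h n)) =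
          (LINT y|lborel. complex_of_real (gauss y) * cis (y \<bullet> ((\<eta> - \<xi>) /\<^sub>R h n)))"
        unfolding fourier_gauss Q_def ..
      also have "\<dots> = h n ^ DIM('a) * (LINT y|lborel. gauss (h n *\<^sub>R y) * cis (y \<bullet> (\<eta> - \<xi>)))"
      proof -
        have hi: "inverse (h n) * (h n * t) = t" for t
          using h[of n] by (simp flip: mult.assoc)
        show ?thesis
          by (subst integral_lborel_affine[of "h n" _ 0]) (use h[of n] in \<open>simp_all add: scaleR_conv_of_real hi\<close>)
      qed
      finally show "(LINT y|lborel. ?F y \<eta>) = w \<eta> * (Q / h n ^ DIM('a) * gauss ((\<eta> - \<xi>) /\<^sub>R h n))"
        using h[of n] by (simp add: field_simps)
    qed
    also have "\<dots> = h n ^ DIM('a) * (LINT z|lborel. w (\<xi> + h n *\<^sub>R z) * (Q / h n ^ DIM('a) * gauss z))"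
      by (subst integral_lborel_affine[of "h n" _ \<xi>]) (use h[of n] in \<open>simp_all add: scaleR_conv_of_real\<close>)
    also have "\<dots> = Q * (LINT z|lborel. w (\<xi> + h n *\<^sub>R z) * gauss z)"
    proof -
      have eq: "w (\<xi> + h n *\<^sub>R z) * (Q / h n ^ DIM('a) * gauss z) = (Q / h n ^ DIM('a)) * (w (\<xi> + h n *\<^sub>R z) * gauss z)" for z
        by simp
      have "(LINT z|lborel. w (\<xi> + h n *\<^sub>R z) * (Q / h n ^ DIM('a) * gauss z)) =
          (Q / h n ^ DIM('a)) * (LINT z|lborel. w (\<xi> + h n *\<^sub>R z) * gauss z)"
        unfolding eq integral_mult_right_zero ..
      then show ?thesis using h[of n] by simp
    qed
    finally show ?thesis using Q by (simp add: power2_eq_square field_simps)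
  qed
  have lim: "(\<lambda>n. LINT z|lborel. w (\<xi> + h n *\<^sub>R z) * gauss z) \<longlonglongrightarrow> (LINT z|lborel. w \<xi> * gauss (z::'a))"
  proof (rule integral_dominated_convergence[where w = "\<lambda>z. C * gauss z"])
    have "(\<lambda>n. w (\<xi> + h n *\<^sub>R z)) \<longlonglongrightarrow> w \<xi>" for z
    proof -
      have "isCont w \<xi>" using w(1) by (simp add: continuous_on_eq_continuous_at)
      then show ?thesis
        by (rule isCont_tendsto_compose) (use tendsto_add[OF tendsto_const[of \<xi>] tendsto_scaleR[OF h0 tendsto_const, of z]] in simp)
    qed
    then show "AE z in lborel. (\<lambda>n. w (\<xi> + h n *\<^sub>R z) * gauss z) \<longlonglongrightarrow> w \<xi> * gauss z"
      by (intro AE_I2 tendsto_intros)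
    show "AE z in lborel. norm (w (\<xi> + h n *\<^sub>R z) * gauss z) \<le> C * gauss z" for n
      using C(2) by (auto simp: norm_mult abs_of_pos[OF gauss_pos] intro!: AE_I2 mult_right_mono less_imp_le[OF gauss_pos])
  qed (simp_all add: integrable_gauss)
  have "(LINT z|lborel. w \<xi> * gauss (z::'a)) = w \<xi>"
    by (simp add: integral_gauss)
  with tendsto_mult_left[OF lim, of "complex_of_real (inverse Q)"] have "J \<longlonglongrightarrow> inverse Q * w \<xi>"
    by (simp only: J[symmetric])
  from LIMSEQ_unique[OF 1 this] show ?thesis using Q by simp
qed

section \<open>Distributions given by bounded functions\<close>

lemma partial_derivs_scaleR:
  assumes "smooth f" "set bs \<subseteq> Basis"
  shows "partial_derivs bs (\<lambda>x. f (c *\<^sub>R x)) = (\<lambda>x. c ^ length bs *\<^sub>R partial_derivs bs f (c *\<^sub>R x))"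
  using assms(2)
proof (induction bs)
  case (Cons b bs)
  show ?case
  proof
    fix x
    let ?D = "frechet_derivative (partial_derivs bs f) (at (c *\<^sub>R x))"
    have D: "(partial_derivs bs f has_derivative ?D) (at (c *\<^sub>R x))"
      using smooth_partial_derivs_has_derivative[OF assms(1)] Cons.prems by simp
    have "((\<lambda>x. partial_derivs bs f (c *\<^sub>R x)) has_derivative (\<lambda>h. ?D (c *\<^sub>R h))) (at x)"
      by (rule has_derivative_compose[of "\<lambda>x. c *\<^sub>R x" "\<lambda>h. c *\<^sub>R h", OF _ D]) (auto intro!: derivative_eq_intros)
    then have "((\<lambda>x. c ^ length bs *\<^sub>R partial_derivs bs f (c *\<^sub>R x)) has_derivative (\<lambda>h. c ^ length bs *\<^sub>R ?D (c *\<^sub>R h))) (at x)"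
      by (rule has_derivative_scaleR_right)
    then have "partial_derivs (b # bs) (\<lambda>x. f (c *\<^sub>R x)) x = c ^ length bs *\<^sub>R ?D (c *\<^sub>R b)"
      using Cons by (simp add: partial_derivs_Cons flip: frechet_derivative_at)
    then show "partial_derivs (b # bs) (\<lambda>x. f (c *\<^sub>R x)) x = c ^ length (b # bs) *\<^sub>R partial_derivs (b # bs) f (c *\<^sub>R x)"
      using linear_scale[OF has_derivative_linear[OF D]] by (simp add: partial_derivs_Cons mult.commute)
  qed
qed simp

lemma smooth_scaleR: "smooth f \<Longrightarrow> smooth (\<lambda>x. f (c *\<^sub>R x))"
  unfolding smooth_def[of "\<lambda>x. f (c *\<^sub>R x)"]
proof (intro ballI allI)
  fix bs :: "'a list" and x
  assume f: "smooth f" and bs: "bs \<in> lists Basis"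
  have "(partial_derivs bs f \<circ> (\<lambda>x. c *\<^sub>R x)) differentiable at x"
    using f bs unfolding smooth_def by (intro differentiable_chain_at) (auto intro!: derivative_intros)
  then have "(\<lambda>x. partial_derivs bs f (c *\<^sub>R x)) differentiable at x"
    by (simp add: comp_def)
  then show "partial_derivs bs (\<lambda>x. f (c *\<^sub>R x)) differentiable at x"
    using partial_derivs_scaleR[OF f, of bs c] bs by (simp add: in_lists_conv_set subset_eq)
qed

lemma partial_derivs_diff:
  assumes "smooth f" "smooth g" "set bs \<subseteq> Basis"
  shows "partial_derivs bs (\<lambda>x. f x - g x) = (\<lambda>x. partial_derivs bs f x - partial_derivs bs g x)"
  using assms(3)
proof (induction bs)
  case (Cons b bs)
  show ?case
  proof
    fix x
    have "((\<lambda>x. partial_derivs bs f x - partial_derivs bs g x) has_derivative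
       (\<lambda>h. frechet_derivative (partial_derivs bs f) (at x) h - frechet_derivative (partial_derivs bs g) (at x) h)) (at x)"
      by (intro has_derivative_diff smooth_partial_derivs_has_derivative assms) (use Cons.prems in auto)
    then show "partial_derivs (b # bs) (\<lambda>x. f x - g x) x = partial_derivs (b # bs) f x - partial_derivs (b # bs) g x"
      using Cons by (simp add: partial_derivs_Cons flip: frechet_derivative_at)
  qed
qed simp

lemma smooth_diff:
  assumes "smooth f" "smooth g"
  shows "smooth (\<lambda>x. f x - g x)"
  using assms partial_derivs_diff[OF assms]
  unfolding smooth_def by (auto simp: in_lists_conv_set subset_eq)

lemma test_function_scaleR:
  assumes "test_function f" "c \<noteq> 0"
  shows "test_function (\<lambda>x. f (c *\<^sub>R x))"
proof -
  obtain R where R: "\<And>x. R < norm x \<Longrightarrow> f x = 0"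
    using assms unfolding test_function_def by blast
  have "f (c *\<^sub>R x) = 0" if "R / \<bar>c\<bar> < norm x" for x
    using that assms(2) by (intro R) (simp add: field_simps)
  then show ?thesis using assms smooth_scaleR unfolding test_function_def by blast
qed

lemma test_function_diff:
  assumes "test_function f" "test_function g"
  shows "test_function (\<lambda>x. f x - g x)"
proof -
  obtain R R' where "\<And>x. R < norm x \<Longrightarrow> f x = 0" "\<And>x. R' < norm x \<Longrightarrow> g x = 0"
    using assms unfolding test_function_def by blast
  then have "f x - g x = 0" if "max R R' < norm x" for x
    using that by simp
  then show ?thesis using assms smooth_diff unfolding test_function_def by blast
qed

lemma inv_fourier_diff:
  fixes f g :: "'a::euclidean_space \<Rightarrow> complex"
  assumes "integrable lborel f" "integrable lborel g"
  shows "inv_fourier (\<lambda>\<xi>. f \<xi> - g \<xi>) x = inv_fourier f x - inv_fourier g x"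
proof -
  have "integrable lborel (\<lambda>\<xi>. h \<xi> * cis (x \<bullet> \<xi>))" if "integrable lborel h" for h
    using that by (rule integrable_mult_cis) simp
  then show ?thesis
    using assms by (simp add: inv_fourier_def left_diff_distrib diff_divide_distrib)
qed

lemma inv_fourier_scaleR:
  fixes f :: "'a::euclidean_space \<Rightarrow> complex"
  assumes "0 < c"
  shows "inv_fourier (\<lambda>\<xi>. f (\<xi> /\<^sub>R c)) x = c ^ DIM('a) * inv_fourier f (c *\<^sub>R x)"
  unfolding inv_fourier_def
  by (subst integral_lborel_affine[of c _ 0]) (use assms in \<open>simp_all add: scaleR_conv_of_real\<close>)

text \<open>Dilating a symbol preserves the L1 norm of its kernel. This makes the dyadic blocks
  bounded on bounded functions uniformly in the index.\<close>

lemma integral_norm_inv_fourier_scaleR: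
  fixes f :: "'a::euclidean_space \<Rightarrow> complex"
  assumes "0 < c"
  shows "(LINT x|lborel. norm (inv_fourier (\<lambda>\<xi>. f (\<xi> /\<^sub>R c)) x)) = (LINT x|lborel. norm (inv_fourier f x))"
  by (subst (2) integral_lborel_affine[of c _ 0])
    (use assms in \<open>simp_all add: inv_fourier_scaleR norm_mult norm_power\<close>)

section \<open>Bounded functions as tempered distributions\<close>

definition dist_of :: "('a::euclidean_space \<Rightarrow> complex) \<Rightarrow> 'a dist" where
  "dist_of U = (\<lambda>f. LINT y|lborel. U y * f y)"

lemma schwartz_decay:
  fixes f :: "'a::euclidean_space \<Rightarrow> complex"
  assumes "schwartz f"
  shows "(1 + norm x) ^ N * norm (f x) \<le> schwartz_seminorm N f"
proof -
  let ?q = "\<lambda>bs x. (1 + norm x) ^ N * norm (partial_derivs bs f x)"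
  let ?B = "{bs. set bs \<subseteq> (Basis :: 'a set) \<and> length bs \<le> N}"
  \<comment> \<open>A real-valued supremum is an upper bound only for sets bounded above; the
    Schwartz property supplies this.\<close>
  have bdd: "bdd_above (range (?q bs))" if "bs \<in> ?B" for bs
    using assms that unfolding schwartz_def by (intro bounded_imp_bdd_above) (auto simp: in_lists_conv_set)
  have "?q [] x \<le> (SUP x. ?q [] x)"
    by (rule cSUP_upper[OF UNIV_I bdd]) simp
  also have "\<dots> \<le> (\<Sum>bs\<in>?B. SUP x. ?q bs x)"
  proof (rule member_le_sum)
    show "finite ?B" by (rule finite_lists_length_le) simp
    show "0 \<le> (SUP x. ?q bs x)" if "bs \<in> ?B - {[]}" for bs
      by (rule order_trans[OF _ cSUP_upper[OF UNIV_I bdd, of bs 0]]) (use that in auto)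
  qed simp
  finally show ?thesis by (simp add: schwartz_seminorm_def)
qed

lemma schwartz_le_peak:
  fixes f :: "'a::euclidean_space \<Rightarrow> complex"
  assumes "schwartz f"
  shows "norm (f x) \<le> schwartz_seminorm (2 * DIM('a)) f * peak x"
proof -
  have "0 < (1 + norm x) ^ (2 * DIM('a))" by (simp add: add_pos_nonneg)
  then show ?thesis using schwartz_decay[OF assms, of x "2 * DIM('a)"] by (simp add: field_simps)
qed

text \<open>The seminorm of order 2 d controls decay like \<open>peak\<close>, which suffices to
  integrate against a bounded function.\<close>

lemma tempered_dist_of:
  fixes U :: "'a::euclidean_space \<Rightarrow> complex"
  assumes U[measurable]: "U \<in> borel_measurable borel" and bound: "\<And>y. norm (U y) \<le> S"
  shows "tempered (dist_of U)"
proof -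
  have S: "0 \<le> S" using bound[of 0] norm_ge_zero order_trans by blast
  have le: "norm (U y * f y) \<le> S * (schwartz_seminorm (2 * DIM('a)) f * peak y)" if "schwartz f" for f y
    unfolding norm_mult by (intro mult_mono bound schwartz_le_peak[OF that] S) simp
  have int: "integrable lborel (\<lambda>y. U y * f y)" if "schwartz f" for f
  proof (rule Bochner_Integration.integrable_bound)
    show "integrable lborel (\<lambda>y::'a. S * (schwartz_seminorm (2 * DIM('a)) f * peak y))"
      by (intro integrable_mult_right integrable_peak)
    have "f \<in> borel_measurable borel"
      using that smooth_continuous_on unfolding schwartz_def by (intro borel_measurable_continuous_onI) blast
    then show "(\<lambda>y. U y * f y) \<in> borel_measurable lborel" by simp
    show "AE y in lborel. norm (U y * f y) \<le> norm (S * (schwartz_seminorm (2 * DIM('a)) f * peak y))"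
      by (intro AE_I2 order_trans[OF le[OF that]]) simp
  qed
  have "norm (dist_of U f) \<le> (S * (LINT y|lborel. peak (y::'a))) * schwartz_seminorm (2 * DIM('a)) f"
    if "schwartz f" for f
  proof -
    have "norm (dist_of U f) \<le> (LINT y|lborel. norm (U y * f y))"
      unfolding dist_of_def by (rule integral_norm_bound)
    also have "\<dots> \<le> (LINT y|lborel. S * (schwartz_seminorm (2 * DIM('a)) f * peak (y::'a)))"
    proof (rule integral_mono)
      show "integrable lborel (\<lambda>y::'a. S * (schwartz_seminorm (2 * DIM('a)) f * peak y))"
        by (intro integrable_mult_right integrable_peak)
    qed (use le int that in auto)
    finally show ?thesis by (simp add: mult_ac)
  qed
  moreover have "dist_of U (\<lambda>x. f x + g x) = dist_of U f + dist_of U g" if "schwartz f" "schwartz g" for f g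
    using int that by (simp add: dist_of_def distrib_left)
  moreover have "dist_of U (\<lambda>x. c * f x) = c * dist_of U f" for c f
    by (simp add: dist_of_def mult.left_commute)
  ultimately show ?thesis unfolding tempered_def by blast
qed

lemma smooth_multiplier_dist_of:
  fixes U p :: "'a::euclidean_space \<Rightarrow> complex"
  assumes "integrable lborel U" "integrable lborel p"
  shows "smooth_multiplier p (dist_of U) x = inv_fourier (\<lambda>\<xi>. p \<xi> * fourier U \<xi>) x"
  using integral_mult_inv_fourier[OF assms] by (simp add: smooth_multiplier_def dist_of_def)

text \<open>Young's inequality for a bounded function and an integrable kernel.\<close>

lemma norm_smooth_multiplier_dist_of_le:
  fixes U p :: "'a::euclidean_space \<Rightarrow> complex"
  assumes U: "\<And>y. norm (U y) \<le> S" and p: "test_function p"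
  shows "norm (smooth_multiplier p (dist_of U) x) \<le> S * (LINT y|lborel. norm (inv_fourier p y))"
proof -
  have S: "0 \<le> S" using U[of 0] norm_ge_zero order_trans by blast
  have i: "integrable lborel (\<lambda>y. norm (inv_fourier p (x - y)))"
    using integrable_norm[OF integrable_inv_fourier_test_function[OF p]]
      integrable_lborel_reflect[of "\<lambda>y. norm (inv_fourier p y)" x] by simp
  have "norm (smooth_multiplier p (dist_of U) x) \<le> (LINT y|lborel. norm (U y * inv_fourier p (x - y)))"
    unfolding smooth_multiplier_def dist_of_def by (rule integral_norm_bound)
  also have "\<dots> \<le> (LINT y|lborel. S * norm (inv_fourier p (x - y)))"
    using i U S by (intro integral_mono') (auto simp: norm_mult intro: mult_right_mono)
  also have "\<dots> = S * (LINT y|lborel. norm (inv_fourier p y))"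
    using integral_lborel_reflect[of "\<lambda>y. norm (inv_fourier p y)" x] by simp
  finally show ?thesis .
qed

section \<open>The phase and its gradient on an annulus\<close>

definition phase :: "real \<Rightarrow> 'a::euclidean_space \<Rightarrow> real" where
  "phase \<alpha> \<xi> = norm \<xi> powr \<alpha>"

definition phase_grad :: "real \<Rightarrow> 'a::euclidean_space \<Rightarrow> 'a" where
  "phase_grad \<alpha> \<xi> = (\<alpha> * norm \<xi> powr (\<alpha> - 2)) *\<^sub>R \<xi>"

text \<open>Mean value theorem: the derivative \<beta> z^(\<beta> - 1) has monotone modulus, so it
  is smallest at an endpoint of [a, b]. With \<beta> = \<alpha> - 1 this is where \<alpha> \<noteq>
  1 enters.\<close>

lemma powr_diff_ge:
  fixes \<beta> :: real
  assumes "\<beta> \<noteq> 0" "0 < a" "a \<le> b"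
  obtains c where "0 < c" "\<And>p q. \<lbrakk>a \<le> p; p \<le> b; a \<le> q; q \<le> b\<rbrakk> \<Longrightarrow> c * \<bar>p - q\<bar> \<le> \<bar>p powr \<beta> - q powr \<beta>\<bar>"
proof -
  define c where "c = \<bar>\<beta>\<bar> * min (a powr (\<beta> - 1)) (b powr (\<beta> - 1))"
  have "0 < c" using assms by (simp add: c_def)
  have lt: "c * (q - p) \<le> \<bar>q powr \<beta> - p powr \<beta>\<bar>" if "a \<le> p" "p < q" "q \<le> b" for p q
  proof -
    have "\<exists>z>p. z < q \<and> q powr \<beta> - p powr \<beta> = (q - p) * (\<beta> * z powr (\<beta> - 1))"
      by (rule MVT2) (use that assms in \<open>auto intro!: derivative_eq_intros\<close>)
    then obtain z where z: "p < z" "z < q" "q powr \<beta> - p powr \<beta> = (q - p) * (\<beta> * z powr (\<beta> - 1))" by blast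
    have "min (a powr (\<beta> - 1)) (b powr (\<beta> - 1)) \<le> z powr (\<beta> - 1)"
    proof (cases "\<beta> \<ge> 1")
      case True
      then have "a powr (\<beta> - 1) \<le> z powr (\<beta> - 1)" using z that assms by (intro powr_mono2) auto
      then show ?thesis by simp
    next
      case False
      then have "b powr (\<beta> - 1) \<le> z powr (\<beta> - 1)" using z that assms by (intro powr_mono2') auto
      then show ?thesis by simp
    qed
    then have "c \<le> \<bar>\<beta>\<bar> * z powr (\<beta> - 1)" unfolding c_def by (intro mult_left_mono) auto
    then have "c * (q - p) \<le> \<bar>\<beta>\<bar> * z powr (\<beta> - 1) * (q - p)" using z by (intro mult_right_mono) auto
    also have "\<dots> = \<bar>q powr \<beta> - p powr \<beta>\<bar>" using z by (simp add: abs_mult)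
    finally show ?thesis .
  qed
  have "c * \<bar>p - q\<bar> \<le> \<bar>p powr \<beta> - q powr \<beta>\<bar>" if "a \<le> p" "p \<le> b" "a \<le> q" "q \<le> b" for p q
    using lt[of p q] lt[of q p] that by (cases p q rule: linorder_cases) (auto simp: abs_minus_commute)
  then show ?thesis using \<open>0 < c\<close> that by blast
qed

text \<open>Splits \<open>|G x - G y|\<^sup>2\<close>, for \<open>G = phase_grad \<alpha>\<close>, into a radial and an angular part, so that only a bound
  for the one-variable function \<open>p\<^sup>\<alpha>\<^sup>-\<^sup>1\<close> is needed.\<close>

lemma norm_radial_diff:
  fixes x y :: "'a::real_inner"
  shows "(norm (u *\<^sub>R x - v *\<^sub>R y))\<^sup>2 =
    (u * norm x - v * norm y)\<^sup>2 + 2 * (u * v) * (norm x * norm y - x \<bullet> y)"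
proof -
  have "(norm (u *\<^sub>R x - v *\<^sub>R y))\<^sup>2 = u\<^sup>2 * (norm x)\<^sup>2 + v\<^sup>2 * (norm y)\<^sup>2 - 2 * (u * v) * (x \<bullet> y)"
    by (simp only: power2_norm_eq_inner inner_diff_left inner_diff_right inner_scaleR_left inner_scaleR_right
        inner_commute[of y x]) (simp add: algebra_simps power2_eq_square)
  then show ?thesis by (simp add: algebra_simps power2_eq_square)
qed

text \<open>Up to the factor \<alpha>, the radial splitting with u = |x|^(\<alpha> - 2) and v =
  |y|^(\<alpha> - 2) describes the difference of gradients, and with u = v = 1 it describes x - y.
  The two are compared term by term; the angular term is nonnegative by Cauchy-Schwarz.\<close>

lemma phase_grad_diff_ge:
  fixes \<alpha> :: real
  assumes "0 < \<alpha>" "\<alpha> \<noteq> 1" "0 < a" "a \<le> b"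
  obtains c where "0 < c"
    "\<And>x y :: 'a::euclidean_space. \<lbrakk>a \<le> norm x; norm x \<le> b; a \<le> norm y; norm y \<le> b\<rbrakk> \<Longrightarrow>
      c * norm (x - y) \<le> norm (phase_grad \<alpha> x - phase_grad \<alpha> y)"
proof -
  obtain c1 where c1: "0 < c1"
    "\<And>p q. \<lbrakk>a \<le> p; p \<le> b; a \<le> q; q \<le> b\<rbrakk> \<Longrightarrow> c1 * \<bar>p - q\<bar> \<le> \<bar>p powr (\<alpha> - 1) - q powr (\<alpha> - 1)\<bar>"
    using powr_diff_ge[of "\<alpha> - 1" a b] assms by auto
  \<comment> \<open>The power is increasing or decreasing according to the sign of \<alpha> - 2; in
    both cases its minimum over [a, b] is attained at an endpoint.\<close>
  define m where "m = min (a powr (\<alpha> - 2)) (b powr (\<alpha> - 2))"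
  have m: "0 < m" "m \<le> p powr (\<alpha> - 2)" if "a \<le> p" "p \<le> b" for p
  proof -
    show "0 < m" using assms by (simp add: m_def)
    have "a powr (\<alpha> - 2) \<le> p powr (\<alpha> - 2) \<or> b powr (\<alpha> - 2) \<le> p powr (\<alpha> - 2)"
      using that assms powr_mono2[of "\<alpha> - 2" a p] powr_mono2'[of "\<alpha> - 2" p b] by linarith
    then show "m \<le> p powr (\<alpha> - 2)" by (auto simp: m_def)
  qed
  define c where "c = \<alpha> * min c1 m"
  have "0 < c" using assms c1 m(1)[of a] by (simp add: c_def)
  moreover have "c * norm (x - y) \<le> norm (phase_grad \<alpha> x - phase_grad \<alpha> y)"
    if x: "a \<le> norm x" "norm x \<le> b" and y: "a \<le> norm y" "norm y \<le> b" for x y :: 'a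
  proof -
    let ?u = "norm x powr (\<alpha> - 2)" and ?v = "norm y powr (\<alpha> - 2)"
    let ?e = "norm x * norm y - x \<bullet> y"
    have e: "0 \<le> ?e" using norm_cauchy_schwarz[of x y] by simp
    have r: "z powr (\<alpha> - 2) * z = z powr (\<alpha> - 1)" if "0 < z" for z
      using that powr_add[of z "\<alpha> - 2" 1] by simp
    have m0: "0 < m" using m(1)[OF x] .
    have mc: "0 \<le> min c1 m" using c1 m0 by simp
    have "(min c1 m)\<^sup>2 * (norm (x - y))\<^sup>2 = (min c1 m)\<^sup>2 * (norm x - norm y)\<^sup>2 + 2 * (min c1 m)\<^sup>2 * ?e"
    proof -
      have "(norm (x - y))\<^sup>2 = (norm x - norm y)\<^sup>2 + 2 * ?e"
        using norm_radial_diff[of 1 x 1 y] by simp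
      then show ?thesis by (simp only: distrib_left mult_ac)
    qed
    also have "(min c1 m)\<^sup>2 * (norm x - norm y)\<^sup>2 \<le> (norm x powr (\<alpha> - 1) - norm y powr (\<alpha> - 1))\<^sup>2"
    proof -
      have "min c1 m * \<bar>norm x - norm y\<bar> \<le> c1 * \<bar>norm x - norm y\<bar>" by (intro mult_right_mono) auto
      also have "\<dots> \<le> \<bar>norm x powr (\<alpha> - 1) - norm y powr (\<alpha> - 1)\<bar>" using c1(2) x y by blast
      finally have "(min c1 m * \<bar>norm x - norm y\<bar>)\<^sup>2 \<le> \<bar>norm x powr (\<alpha> - 1) - norm y powr (\<alpha> - 1)\<bar>\<^sup>2"
        using mc by (intro power_mono) auto
      then show ?thesis by (simp add: power_mult_distrib)
    qed
    also have "2 * (min c1 m)\<^sup>2 * ?e \<le> 2 * (?u * ?v) * ?e"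
    proof -
      have "min c1 m * min c1 m \<le> ?u * ?v"
        using m(2)[OF x] m(2)[OF y] mc by (intro mult_mono) auto
      then show ?thesis using e by (intro mult_right_mono) (auto simp: power2_eq_square)
    qed
    finally have "(min c1 m)\<^sup>2 * (norm (x - y))\<^sup>2 \<le>
        (norm x powr (\<alpha> - 1) - norm y powr (\<alpha> - 1))\<^sup>2 + 2 * (?u * ?v) * ?e" by simp
    then have "(min c1 m * norm (x - y))\<^sup>2 \<le> (norm (?u *\<^sub>R x - ?v *\<^sub>R y))\<^sup>2"
    proof -
      have "0 < norm x" "0 < norm y" using x y assms by linarith+
      then show ?thesis
        using \<open>(min c1 m)\<^sup>2 * (norm (x - y))\<^sup>2 \<le> _\<close>
        by (simp add: norm_radial_diff power_mult_distrib r)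
    qed
    then have le: "min c1 m * norm (x - y) \<le> norm (?u *\<^sub>R x - ?v *\<^sub>R y)"
      by (rule power2_le_imp_le) simp
    have "phase_grad \<alpha> x - phase_grad \<alpha> y = \<alpha> *\<^sub>R (?u *\<^sub>R x - ?v *\<^sub>R y)"
      by (simp add: phase_grad_def scaleR_diff_right)
    then show ?thesis using mult_left_mono[OF le, of \<alpha>] assms by (simp add: c_def)
  qed
  ultimately show ?thesis using that by blast
qed

text \<open>The mean value inequality is applied twice, to the derivative and to the function minus
  its linear part. On [a, b], away from 0, the second derivative is bounded for every real
  exponent.\<close>

lemma powr_second_order:
  fixes \<beta> :: real
  assumes "0 < a" "a \<le> b"
  obtains C where "0 < C"
    "\<And>p q. \<lbrakk>a \<le> p; p \<le> b; a \<le> q; q \<le> b\<rbrakk> \<Longrightarrow>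
      \<bar>p powr \<beta> - q powr \<beta> - \<beta> * q powr (\<beta> - 1) * (p - q)\<bar> \<le> C * (p - q)\<^sup>2"
proof -
  define f' :: "real \<Rightarrow> real" where "f' = (\<lambda>z. \<beta> * z powr (\<beta> - 1))"
  define f'' :: "real \<Rightarrow> real" where "f'' = (\<lambda>z. \<beta> * ((\<beta> - 1) * z powr (\<beta> - 1 - 1)))"
  have d1: "((\<lambda>z. z powr \<beta>) has_real_derivative f' z) (at z)" if "0 < z" for z
    using that unfolding f'_def by (auto intro!: derivative_eq_intros)
  have d2: "(f' has_real_derivative f'' z) (at z)" if "0 < z" for z
    using that unfolding f'_def f''_def by (auto intro!: derivative_eq_intros)
  have "compact (f'' ` {a..b})"
    using assms unfolding f''_def by (intro compact_continuous_image continuous_intros) auto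
  then obtain C where C: "0 < C" "\<And>y. y \<in> f'' ` {a..b} \<Longrightarrow> norm y \<le> C"
    using bounded_pos compact_imp_bounded by metis
  have C': "\<bar>f'' z\<bar> \<le> C" if "a \<le> z" "z \<le> b" for z using C(2)[of "f'' z"] that by auto
  have "\<bar>p powr \<beta> - q powr \<beta> - f' q * (p - q)\<bar> \<le> C * (p - q)\<^sup>2"
    if pq: "a \<le> p" "p \<le> b" "a \<le> q" "q \<le> b" for p q
  proof -
    let ?I = "closed_segment q p"
    have seg: "a \<le> z" "z \<le> b" "0 < z" if "z \<in> ?I" for z
      using that pq assms by (auto simp: closed_segment_eq_real_ivl split: if_splits)
    have f'l: "norm (f' z - f' q) \<le> C * norm (z - q)" if z: "z \<in> ?I" for z
    proof (rule field_differentiable_bound[where S = ?I and f' = f''])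
      show "(f' has_field_derivative f'' x) (at x within ?I)" if "x \<in> ?I" for x
        using d2 seg[OF that] has_field_derivative_at_within by blast
    qed (use seg C' z in auto)
    \<comment> \<open>\<open>g\<close> removes the linear part; by the previous bound its derivative
      is at most C |p - q| on the segment.\<close>
    define g where "g z = z powr \<beta> - f' q * z" for z
    have "norm (g p - g q) \<le> (C * \<bar>p - q\<bar>) * norm (p - q)"
    proof (rule field_differentiable_bound[where S = ?I and f' = "\<lambda>z. f' z - f' q"])
      show "(g has_field_derivative f' x - f' q) (at x within ?I)" if "x \<in> ?I" for x
        unfolding g_def
        using DERIV_diff[OF d1[OF seg(3)[OF that]] DERIV_cmult_Id[of "f' q"]]
        by (rule has_field_derivative_at_within)
      show "norm (f' x - f' q) \<le> C * \<bar>p - q\<bar>" if "x \<in> ?I" for x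
      proof -
        have "\<bar>x - q\<bar> \<le> \<bar>p - q\<bar>"
          using that by (auto simp: closed_segment_eq_real_ivl split: if_splits)
        then show ?thesis using f'l[OF that] C(1) by (auto intro: order_trans mult_left_mono)
      qed
    qed auto
    then show ?thesis by (simp add: g_def power2_eq_square algebra_simps abs_mult_self_eq flip: abs_mult)
  qed
  then show ?thesis using C(1) that unfolding f'_def by auto
qed

text \<open>The segment from \<open>y\<close> to \<open>x\<close> may leave the annulus and even
  pass through 0. Taylor's formula is therefore applied to p^(\<alpha>/2) with p = |\<xi>|^2, which
  stays in [a^2, b^2]. The increment of p differs from its linear part 2 y.(x - y) by exactly |x -
  y|^2. This term and the Taylor remainder give the two summands of the constant.\<close>

lemma phase_second_order:
  fixes \<alpha> :: real
  assumes "0 < \<alpha>" "0 < a" "a \<le> b"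
  obtains C where "0 < C"
    "\<And>x y :: 'a::euclidean_space. \<lbrakk>a \<le> norm x; norm x \<le> b; a \<le> norm y; norm y \<le> b\<rbrakk> \<Longrightarrow>
      \<bar>phase \<alpha> x - phase \<alpha> y - phase_grad \<alpha> y \<bullet> (x - y)\<bar> \<le> C * (norm (x - y))\<^sup>2"
proof -
  obtain C1 where C1: "0 < C1"
    "\<And>p q. \<lbrakk>a\<^sup>2 \<le> p; p \<le> b\<^sup>2; a\<^sup>2 \<le> q; q \<le> b\<^sup>2\<rbrakk> \<Longrightarrow>
      \<bar>p powr (\<alpha> / 2) - q powr (\<alpha> / 2) - (\<alpha> / 2) * q powr (\<alpha> / 2 - 1) * (p - q)\<bar> \<le> C1 * (p - q)\<^sup>2"
    using powr_second_order[of "a\<^sup>2" "b\<^sup>2" "\<alpha> / 2"] assms by (auto simp: power_mono)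
  define M where "M = max (a powr (\<alpha> - 2)) (b powr (\<alpha> - 2))"
  have M: "p powr (\<alpha> - 2) \<le> M" if "a \<le> p" "p \<le> b" for p
  proof -
    have "p powr (\<alpha> - 2) \<le> a powr (\<alpha> - 2) \<or> p powr (\<alpha> - 2) \<le> b powr (\<alpha> - 2)"
      using that assms powr_mono2[of "\<alpha> - 2" p b] powr_mono2'[of "\<alpha> - 2" a p] by linarith
    then show ?thesis by (auto simp: M_def)
  qed
  have M0: "0 < M" using assms by (simp add: M_def less_max_iff_disj)
  define C where "C = C1 * (2 * b)\<^sup>2 + \<alpha> / 2 * M"
  have "0 < C" using C1 M0 assms by (auto simp: C_def intro!: add_nonneg_pos)
  moreover have "\<bar>phase \<alpha> x - phase \<alpha> y - phase_grad \<alpha> y \<bullet> (x - y)\<bar> \<le> C * (norm (x - y))\<^sup>2"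
    if x: "a \<le> norm x" "norm x \<le> b" and y: "a \<le> norm y" "norm y \<le> b" for x y :: 'a
  proof -
    let ?p = "(norm x)\<^sup>2" and ?q = "(norm y)\<^sup>2" and ?v = "norm y powr (\<alpha> - 2)"
    have sq: "(z\<^sup>2) powr s = z powr (2 * s)" if "0 < z" for z s :: real
      using that by (simp add: powr_powr flip: powr_numeral)
    have "y \<bullet> (x - y) = (?p - ?q) / 2 - (norm (x - y))\<^sup>2 / 2"
      by (simp add: power2_norm_eq_inner inner_diff_left inner_diff_right inner_commute field_simps)
    then have g: "phase_grad \<alpha> y \<bullet> (x - y) = \<alpha> / 2 * ?v * (?p - ?q) - \<alpha> / 2 * ?v * (norm (x - y))\<^sup>2"
      by (simp only: phase_grad_def inner_scaleR_left) (simp add: algebra_simps)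
    have 1: "\<bar>phase \<alpha> x - phase \<alpha> y - \<alpha> / 2 * ?v * (?p - ?q)\<bar> \<le> C1 * (?p - ?q)\<^sup>2"
    proof -
      have "0 < norm x" "0 < norm y" using x y assms by linarith+
      then have "?p powr (\<alpha> / 2) = norm x powr \<alpha>" "?q powr (\<alpha> / 2) = norm y powr \<alpha>" "?q powr (\<alpha> / 2 - 1) = ?v"
        using sq[of "norm x" "\<alpha> / 2"] sq[of "norm y" "\<alpha> / 2"] sq[of "norm y" "\<alpha> / 2 - 1"]
        by (simp_all add: right_diff_distrib)
      moreover have "a\<^sup>2 \<le> ?p" "?p \<le> b\<^sup>2" "a\<^sup>2 \<le> ?q" "?q \<le> b\<^sup>2"
        using x y assms by (auto intro!: power_mono)
      ultimately show ?thesis using C1(2)[of ?p ?q] by (simp only: phase_def)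
    qed
    have "(?p - ?q)\<^sup>2 \<le> (2 * b * norm (x - y))\<^sup>2"
    proof -
      have "\<bar>?p - ?q\<bar> = \<bar>norm x - norm y\<bar> * (norm x + norm y)"
        by (simp add: power2_eq_square square_diff_square_factored abs_mult)
      also have "\<dots> \<le> norm (x - y) * (2 * b)"
        using x y by (intro mult_mono norm_triangle_ineq3) auto
      finally show ?thesis using power_mono[of "\<bar>?p - ?q\<bar>" "norm (x - y) * (2 * b)" 2] by (simp add: mult_ac)
    qed
    then have 2: "C1 * (?p - ?q)\<^sup>2 \<le> C1 * (2 * b)\<^sup>2 * (norm (x - y))\<^sup>2"
      using C1(1) by (simp add: power_mult_distrib)
    have 3: "\<alpha> / 2 * ?v * (norm (x - y))\<^sup>2 \<le> \<alpha> / 2 * M * (norm (x - y))\<^sup>2"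
      using M[OF y] assms by (intro mult_right_mono mult_left_mono) auto
    have 4: "0 \<le> \<alpha> / 2 * ?v * (norm (x - y))\<^sup>2" using assms by simp
    show ?thesis using 1 2 3 4 unfolding g C_def distrib_right by linarith
  qed
  ultimately show ?thesis using that by blast
qed

section \<open>Zygmund norms of frequency-localized functions\<close>

lemma lp_cutoffE:
  assumes "lp_cutoff \<psi>"
  obtains r R where "0 < r" "r < R" "\<And>\<xi>. norm \<xi> \<le> r \<Longrightarrow> \<psi> \<xi> = 1" "\<And>\<xi>. R \<le> norm \<xi> \<Longrightarrow> \<psi> \<xi> = 0"
    "test_function (\<lambda>\<xi>. complex_of_real (\<psi> \<xi>))"
proof -
  obtain r R where rR: "0 < r" "r < R" "\<And>\<xi>. norm \<xi> \<le> r \<Longrightarrow> \<psi> \<xi> = 1" "\<And>\<xi>. R \<le> norm \<xi> \<Longrightarrow> \<psi> \<xi> = 0"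
    using assms unfolding lp_cutoff_def by blast
  have "smooth (\<lambda>\<xi>. complex_of_real (\<psi> \<xi>))"
    using assms unfolding lp_cutoff_def by blast
  moreover have "\<forall>\<xi>. R < norm \<xi> \<longrightarrow> complex_of_real (\<psi> \<xi>) = 0"
    using rR(4) by simp
  ultimately have "test_function (\<lambda>\<xi>. complex_of_real (\<psi> \<xi>))"
    unfolding test_function_def by blast
  then show ?thesis using rR that by metis
qed

lemma lp_symbol_0: "lp_symbol \<psi> 0 = (\<lambda>\<xi>. complex_of_real (\<psi> \<xi>))"
  by (rule ext) (simp add: lp_symbol_def)

lemma lp_symbol_Suc:
  "lp_symbol \<psi> (Suc k) = (\<lambda>\<xi>. complex_of_real (\<psi> (\<xi> /\<^sub>R 2 ^ Suc k)) - complex_of_real (\<psi> (\<xi> /\<^sub>R 2 ^ k)))"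
  by (rule ext) (simp add: lp_symbol_def)

lemma test_function_lp_symbol:
  assumes "lp_cutoff \<psi>"
  shows "test_function (lp_symbol \<psi> k)"
proof -
  have t: "test_function (\<lambda>\<xi>. complex_of_real (\<psi> \<xi>))"
    using lp_cutoffE[OF assms] by blast
  show ?thesis
    by (cases k) (auto simp: lp_symbol_0 lp_symbol_Suc simp del: power_Suc
      intro!: t test_function_diff test_function_scaleR[OF t])
qed

text \<open>A block symbol is \<psi> or a difference of two dilates of it, and each dilate has a
  kernel of the same L1 norm.\<close>

lemma integral_norm_inv_fourier_lp_symbol_le:
  fixes \<psi> :: "'a::euclidean_space \<Rightarrow> real"
  assumes "lp_cutoff \<psi>"
  shows "(LINT x|lborel. norm (inv_fourier (lp_symbol \<psi> k) x)) \<le>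
    2 * (LINT x|lborel. norm (inv_fourier (\<lambda>\<xi>. complex_of_real (\<psi> \<xi>)) (x::'a)))"
proof (cases k)
  case 0
  then show ?thesis by (simp add: lp_symbol_0)
next
  case (Suc n)
  let ?\<psi> = "\<lambda>\<xi>. complex_of_real (\<psi> \<xi>)"
  have t: "test_function ?\<psi>" using lp_cutoffE[OF assms] by blast
  have ts: "test_function (\<lambda>\<xi>. ?\<psi> (\<xi> /\<^sub>R 2 ^ n))" for n
    by (rule test_function_scaleR[OF t]) simp
  then have i: "integrable lborel (\<lambda>\<xi>. ?\<psi> (\<xi> /\<^sub>R 2 ^ n))" for n
    using test_functionE by blast
  have j: "integrable lborel (\<lambda>x. norm (inv_fourier (\<lambda>\<xi>. ?\<psi> (\<xi> /\<^sub>R 2 ^ n)) x))" for n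
    by (intro integrable_norm integrable_inv_fourier_test_function ts)
  have "(LINT x|lborel. norm (inv_fourier (lp_symbol \<psi> k) x)) \<le>
     (LINT x|lborel. norm (inv_fourier (\<lambda>\<xi>. ?\<psi> (\<xi> /\<^sub>R 2 ^ Suc n)) x) + norm (inv_fourier (\<lambda>\<xi>. ?\<psi> (\<xi> /\<^sub>R 2 ^ n)) x))"
    unfolding Suc lp_symbol_Suc inv_fourier_diff[OF i i]
    by (intro integral_mono' Bochner_Integration.integrable_add j norm_triangle_ineq4) simp
  also have "\<dots> = 2 * (LINT x|lborel. norm (inv_fourier ?\<psi> x))"
    using j integral_norm_inv_fourier_scaleR[of "2 ^ n" ?\<psi> for n] by (simp del: power_Suc)
  finally show ?thesis .
qed

lemma zygmund_norm_zero: "zygmund_norm \<psi> \<sigma> (\<lambda>f. 0) = 0"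
  by (simp add: zygmund_norm_def lp_block_def smooth_multiplier_def[abs_def] sup_norm_def)

lemma tempered_zero: "tempered (\<lambda>f. 0)"
  unfolding tempered_def by (auto intro!: exI[of _ 0])

text \<open>Since the operator is given by its graph, continuity at 0 has to be tested at a pair of
  the graph.\<close>

lemma fourier_multiplier_zero: "fourier_multiplier m (\<lambda>f. 0) (\<lambda>f. 0)"
  by (simp add: fourier_multiplier_def tempered_zero smooth_multiplier_def)

text \<open>Weights of blocks at distance at most \<open>E\<close> are comparable; |\<sigma>| covers
  both signs of \<sigma>.\<close>

lemma powr_shift_le:
  fixes j k E :: nat
  assumes "j \<le> E + k" "k \<le> E + j"
  shows "2 powr (real k * \<sigma>) \<le> 2 powr (real E * \<bar>\<sigma>\<bar>) * 2 powr (real j * \<sigma>)"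
proof -
  have "\<bar>real k - real j\<bar> \<le> real E" using assms by linarith
  then have "\<bar>real k - real j\<bar> * \<bar>\<sigma>\<bar> \<le> real E * \<bar>\<sigma>\<bar>" by (intro mult_right_mono) auto
  then have "(real k - real j) * \<sigma> \<le> real E * \<bar>\<sigma>\<bar>" by (simp flip: abs_mult)
  then have "real k * \<sigma> \<le> real E * \<bar>\<sigma>\<bar> + real j * \<sigma>" by (simp add: left_diff_distrib)
  then show ?thesis by (simp flip: powr_add)
qed

text \<open>Frequencies of size 2^j meet only blocks with |j - k| \<le> E, written without
  subtraction of natural numbers. \<open>E\<close> depends on the radii alone: R 2^k bounds the
  support of block \<open>k\<close> from outside and, for k > 0, r 2^(k - 1) from inside.\<close>

lemma lp_symbol_nonzero_bounds:
  fixes \<psi> :: "'a::euclidean_space \<Rightarrow> real"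
  assumes "lp_cutoff \<psi>" "0 < a" "a \<le> b"
  obtains E :: nat where "\<And>j k \<xi>. \<lbrakk>lp_symbol \<psi> k \<xi> \<noteq> 0; a * 2 ^ j \<le> norm \<xi>; norm \<xi> \<le> b * 2 ^ j\<rbrakk> \<Longrightarrow>
    j \<le> E + k \<and> k \<le> E + j"
proof -
  obtain r R where rR: "0 < r" "r < R" "\<And>\<xi>. norm \<xi> \<le> r \<Longrightarrow> \<psi> \<xi> = 1" "\<And>\<xi>. R \<le> norm \<xi> \<Longrightarrow> \<psi> \<xi> = 0"
    using lp_cutoffE[OF assms(1)] by metis
  obtain E :: nat where E: "max (R / a) (2 * b / r) < 2 ^ E"
    using real_arch_pow[of 2 "max (R / a) (2 * b / r)"] by (auto simp del: max_less_iff_conj)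
  have "j \<le> E + k \<and> k \<le> E + j"
    if nz: "lp_symbol \<psi> k \<xi> \<noteq> 0" and l: "a * 2 ^ j \<le> norm \<xi>" and u: "norm \<xi> \<le> b * 2 ^ j" for j k \<xi>
  proof
    have "norm \<xi> \<le> R * 2 ^ k"
    proof (rule ccontr)
      assume *: "\<not> norm \<xi> \<le> R * 2 ^ k"
      have "\<psi> (\<xi> /\<^sub>R 2 ^ n) = 0" if "n \<le> k" for n
      proof (rule rR(4))
        have "R * 2 ^ n \<le> R * 2 ^ k" using that rR by simp
        then show "R \<le> norm (\<xi> /\<^sub>R 2 ^ n)" using * by (simp add: field_simps)
      qed
      \<comment> \<open>For k = 0 the truncated difference k - 1 is 0, and both instances concern
        the low-frequency block.\<close>
      from this[of k] this[of "k - 1"] show False using nz by (auto simp: lp_symbol_def split: if_splits)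
    qed
    with l have "2 ^ j \<le> R / a * 2 ^ k" using assms by (simp add: field_simps)
    also have "\<dots> \<le> 2 ^ E * 2 ^ k" using E by (intro mult_right_mono) auto
    finally have "(2::real) ^ j \<le> 2 ^ (E + k)" by (simp add: power_add)
    then show "j \<le> E + k" by simp
    show "k \<le> E + j"
    proof (cases k)
      case (Suc n)
      have "r * 2 ^ n \<le> norm \<xi>"
      proof (rule ccontr)
        assume *: "\<not> r * 2 ^ n \<le> norm \<xi>"
        have "\<psi> (\<xi> /\<^sub>R 2 ^ i) = 1" if "n \<le> i" for i
        proof (rule rR(3))
          have "r * 2 ^ n \<le> r * 2 ^ i" using that rR by simp
          then show "norm (\<xi> /\<^sub>R 2 ^ i) \<le> r" using * by (simp add: field_simps)
        qed
        from this[of n] this[of "Suc n"] show False using nz by (simp add: Suc lp_symbol_Suc)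
      qed
      with u have "2 ^ k \<le> 2 * b / r * 2 ^ j" using rR by (simp add: Suc field_simps)
      also have "\<dots> \<le> 2 ^ E * 2 ^ j" using E by (intro mult_right_mono) auto
      finally have "(2::real) ^ k \<le> 2 ^ (E + j)" by (simp add: power_add)
      then show ?thesis by simp
    qed simp
  qed
  then show ?thesis using that by blast
qed

lemma inv_fourier_cmult: "inv_fourier (\<lambda>\<xi>. c * f \<xi>) x = c * inv_fourier f x"
  by (simp add: inv_fourier_def mult.assoc)

lemma integrable_bounded_mult:
  fixes m p :: "'a::euclidean_space \<Rightarrow> complex"
  assumes "integrable lborel p" "m \<in> borel_measurable borel" "\<And>\<xi>. norm (m \<xi>) \<le> 1"
  shows "integrable lborel (\<lambda>\<xi>. m \<xi> * p \<xi>)"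
proof (rule Bochner_Integration.integrable_bound[OF assms(1)])
  note borel_measurable_integrable_lborel[OF assms(1), measurable] assms(2)[measurable]
  show "(\<lambda>\<xi>. m \<xi> * p \<xi>) \<in> borel_measurable lborel" by simp
  show "AE \<xi> in lborel. norm (m \<xi> * p \<xi>) \<le> norm (p \<xi>)"
    using assms(3) by (intro AE_I2) (simp add: norm_mult mult_left_le_one_le)
qed

text \<open>Blocks far from \<open>j\<close> vanish, because by Fourier inversion their symbol is
  multiplied by \<open>w\<close>, which is 0 there. The others are bounded by Young's inequality and
  have weights comparable to 2^(j \<sigma>). The constant does not depend on
  \<open>j\<close>.\<close>

lemma zygmund_norm_dist_of_inv_fourier_le:
  fixes \<psi> :: "'a::euclidean_space \<Rightarrow> real"
  assumes cut: "lp_cutoff \<psi>" and ab: "0 < a" "a \<le> b"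
  obtains C where "0 < C"
    "\<And>w j S. \<lbrakk>continuous_on UNIV w; \<And>\<xi>. w \<xi> \<noteq> 0 \<Longrightarrow> a * 2 ^ j \<le> norm \<xi> \<and> norm \<xi> \<le> b * 2 ^ j;
       integrable lborel (inv_fourier w); \<And>x. norm (inv_fourier w x) \<le> S\<rbrakk> \<Longrightarrow>
      zygmund_norm \<psi> \<sigma> (dist_of (inv_fourier w)) \<le> ennreal (C * 2 powr (real j * \<sigma>) * S)"
proof -
  define A where "A = (LINT x|lborel. norm (inv_fourier (\<lambda>\<xi>. complex_of_real (\<psi> \<xi>)) (x::'a)))"
  have A: "0 \<le> A" unfolding A_def by simp
  obtain E :: nat where E: "\<And>j k \<xi>. \<lbrakk>lp_symbol \<psi> k \<xi> \<noteq> 0; a * 2 ^ j \<le> norm \<xi>; norm \<xi> \<le> b * 2 ^ j\<rbrakk> \<Longrightarrow>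
      j \<le> E + k \<and> k \<le> E + j"
    using lp_symbol_nonzero_bounds[OF cut ab] by metis
  \<comment> \<open>The summand 1 makes \<open>C\<close> positive.\<close>
  define C where "C = 2 powr (real E * \<bar>\<sigma>\<bar>) * (2 * A + 1)"
  have "0 < C" using A by (simp add: C_def add_nonneg_pos)
  moreover have "zygmund_norm \<psi> \<sigma> (dist_of (inv_fourier w)) \<le> ennreal (C * 2 powr (real j * \<sigma>) * S)"
    if w: "continuous_on UNIV w" "\<And>\<xi>. w \<xi> \<noteq> 0 \<Longrightarrow> a * 2 ^ j \<le> norm \<xi> \<and> norm \<xi> \<le> b * 2 ^ j"
      and U: "integrable lborel (inv_fourier w)" "\<And>x. norm (inv_fourier w x) \<le> S" for w j S
    unfolding zygmund_norm_def
  proof (rule SUP_least)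
    fix k
    have S: "0 \<le> S" using U(2)[of 0] norm_ge_zero order_trans by blast
    have w0: "w \<xi> = 0" if "b * 2 ^ j < norm \<xi>" for \<xi> using w(2)[of \<xi>] that by force
    have bd: "2 powr (real k * \<sigma>) * norm (lp_block \<psi> k (dist_of (inv_fourier w)) x) \<le> C * 2 powr (real j * \<sigma>) * S" for x
    proof (cases "j \<le> E + k \<and> k \<le> E + j")
      case True
      have "norm (lp_block \<psi> k (dist_of (inv_fourier w)) x) \<le> S * (2 * A)"
        unfolding lp_block_def
        by (rule order_trans[OF norm_smooth_multiplier_dist_of_le[OF U(2) test_function_lp_symbol[OF cut]]])
          (use integral_norm_inv_fourier_lp_symbol_le[OF cut] S A_def in \<open>auto intro: mult_left_mono\<close>)
      also have "\<dots> \<le> S * (2 * A + 1)" using S by (intro mult_left_mono) auto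
      finally have "2 powr (real k * \<sigma>) * norm (lp_block \<psi> k (dist_of (inv_fourier w)) x) \<le>
          (2 powr (real E * \<bar>\<sigma>\<bar>) * 2 powr (real j * \<sigma>)) * (S * (2 * A + 1))"
        using powr_shift_le True by (intro mult_mono) auto
      then show ?thesis by (simp add: C_def mult_ac)
    next
      case False
      have "integrable lborel (lp_symbol \<psi> k)"
        using test_functionE[OF test_function_lp_symbol[OF cut]] by blast
      moreover have "(\<lambda>\<xi>. lp_symbol \<psi> k \<xi> * w \<xi>) = (\<lambda>_. 0)"
        using False E w(2) by fastforce
      ultimately have "lp_block \<psi> k (dist_of (inv_fourier w)) x = 0"
        unfolding lp_block_def
        by (simp add: smooth_multiplier_dist_of[OF U(1)] fourier_inversion[OF w(1) w0 U(1)] inv_fourier_def)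
      then show ?thesis using \<open>0 < C\<close> S by simp
    qed
    have "ennreal (2 powr (real k * \<sigma>)) * sup_norm (lp_block \<psi> k (dist_of (inv_fourier w))) =
      (SUP x. ennreal (2 powr (real k * \<sigma>) * norm (lp_block \<psi> k (dist_of (inv_fourier w)) x)))"
      unfolding sup_norm_def by (simp add: SUP_mult_left_ennreal ennreal_mult)
    also have "\<dots> \<le> ennreal (C * 2 powr (real j * \<sigma>) * S)"
      by (intro SUP_least ennreal_leI bd)
    finally show "ennreal (2 powr (real k * \<sigma>)) * sup_norm (lp_block \<psi> k (dist_of (inv_fourier w))) \<le>
        ennreal (C * 2 powr (real j * \<sigma>) * S)" .
  qed
  ultimately show ?thesis using that by blast
qed

text \<open>Continuity is only used at \<open>u = 0\<close>; testing it on suitably rescaled \<open>u\<close> yields a quantitative bound.\<close>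

lemma zygmund_continuous_imp_bound:
  fixes \<psi> :: "'a::euclidean_space \<Rightarrow> real"
  assumes cut: "lp_cutoff \<psi>" and cont: "zygmund_continuous \<psi> (fourier_multiplier m) \<sigma> s"
    and m: "m \<in> borel_measurable borel" "\<And>\<xi>. norm (m \<xi>) \<le> 1" and ab: "0 < a" "a \<le> b"
  obtains C where "0 < C"
    "\<And>w j S. \<lbrakk>continuous_on UNIV w; \<And>\<xi>. w \<xi> \<noteq> 0 \<Longrightarrow> a * 2 ^ j \<le> norm \<xi> \<and> norm \<xi> \<le> b * 2 ^ j;
       integrable lborel (inv_fourier w); \<And>x. norm (inv_fourier w x) \<le> S; 0 < S\<rbrakk> \<Longrightarrow>
      2 powr (real j * s) * norm (LINT \<xi>|lborel. m \<xi> * lp_symbol \<psi> j \<xi> * w \<xi>) \<le> C * 2 powr (real j * \<sigma>) * S"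
proof -
  obtain r R where rR: "0 < r" "r < R" "\<And>\<xi>. norm \<xi> \<le> r \<Longrightarrow> \<psi> \<xi> = 1" "\<And>\<xi>. R \<le> norm \<xi> \<Longrightarrow> \<psi> \<xi> = 0"
    and t: "test_function (\<lambda>\<xi>. complex_of_real (\<psi> \<xi>))"
    using lp_cutoffE[OF cut] by metis
  have zero: "(\<lambda>f. 0) \<in> zygmund_space \<psi> \<sigma>"
    by (simp add: zygmund_space_def zygmund_norm_zero tempered_zero)
  obtain \<delta> where \<delta>: "0 < \<delta>" "\<And>u v. \<lbrakk>u \<in> zygmund_space \<psi> \<sigma>; fourier_multiplier m u v; zygmund_norm \<psi> \<sigma> u < ennreal \<delta>\<rbrakk> \<Longrightarrow>
      zygmund_norm \<psi> s v < 1"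
  proof -
    have "\<forall>\<epsilon>>0. \<exists>\<delta>>0. \<forall>u\<in>zygmund_space \<psi> \<sigma>. \<forall>v. fourier_multiplier m u v \<longrightarrow>
        zygmund_norm \<psi> \<sigma> (dist_diff u (\<lambda>f. 0)) < ennreal \<delta> \<longrightarrow>
        zygmund_norm \<psi> s (dist_diff v (\<lambda>f. 0)) < ennreal \<epsilon>"
      using cont zero fourier_multiplier_zero[of m] unfolding zygmund_continuous_def by blast
    from this[rule_format, OF zero_less_one] show ?thesis
      using that by (auto simp: dist_diff_def)
  qed
  obtain C where C: "0 < C"
    "\<And>w j S. \<lbrakk>continuous_on UNIV w; \<And>\<xi>. w \<xi> \<noteq> 0 \<Longrightarrow> a * 2 ^ j \<le> norm \<xi> \<and> norm \<xi> \<le> b * 2 ^ j;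
       integrable lborel (inv_fourier w); \<And>x. norm (inv_fourier w x) \<le> S\<rbrakk> \<Longrightarrow>
      zygmund_norm \<psi> \<sigma> (dist_of (inv_fourier w)) \<le> ennreal (C * 2 powr (real j * \<sigma>) * S)"
    using zygmund_norm_dist_of_inv_fourier_le[OF cut ab] by metis
  define P where "P = ((2 * pi) ^ DIM('a) :: real)"
  have P: "0 < P" by (simp add: P_def)
  have "2 powr (real j * s) * norm (LINT \<xi>|lborel. m \<xi> * lp_symbol \<psi> j \<xi> * w \<xi>) \<le> (2 * C * P / \<delta>) * 2 powr (real j * \<sigma>) * S"
    if w: "continuous_on UNIV w" "\<And>\<xi>. w \<xi> \<noteq> 0 \<Longrightarrow> a * 2 ^ j \<le> norm \<xi> \<and> norm \<xi> \<le> b * 2 ^ j"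
      and U: "integrable lborel (inv_fourier w)" "\<And>x. norm (inv_fourier w x) \<le> S" and S: "0 < S" for w j S
  proof -
    \<comment> \<open>\<open>c\<close> brings the Zygmund norm down to at most \<delta>/2; the
      factor 2 yields the strict inequality required by continuity.\<close>
    define c where "c = \<delta> / (2 * C * 2 powr (real j * \<sigma>) * S)"
    have c: "0 < c" using \<delta> C S by (simp add: c_def)
    define w' where "w' \<xi> = complex_of_real c * w \<xi>" for \<xi>
    have invw': "inv_fourier w' = (\<lambda>x. complex_of_real c * inv_fourier w x)"
      unfolding w'_def by (rule ext) (rule inv_fourier_cmult)
    have w': "continuous_on UNIV w'" "\<And>\<xi>. w' \<xi> \<noteq> 0 \<Longrightarrow> a * 2 ^ j \<le> norm \<xi> \<and> norm \<xi> \<le> b * 2 ^ j"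
      using w unfolding w'_def by (auto intro!: continuous_intros)
    have w0: "w' \<xi> = 0" if "b * 2 ^ j < norm \<xi>" for \<xi> using w'(2)[of \<xi>] that by force
    have U': "integrable lborel (inv_fourier w')" "\<And>x. norm (inv_fourier w' x) \<le> c * S"
      unfolding invw' using U c by (auto simp: norm_mult)
    have Um: "inv_fourier w' \<in> borel_measurable borel"
      using U'(1) by (rule borel_measurable_integrable_lborel)
    have hat: "fourier (inv_fourier w') = w'"
      using fourier_inversion[OF w'(1) w0 U'(1)] by (rule ext)
    let ?u = "dist_of (inv_fourier w')"
    have "zygmund_norm \<psi> \<sigma> ?u \<le> ennreal (C * 2 powr (real j * \<sigma>) * (c * S))"
      by (rule C(2)[OF w' U'])
    also have "C * 2 powr (real j * \<sigma>) * (c * S) = \<delta> / 2"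
      using C S by (simp add: c_def field_simps)
    finally have le: "zygmund_norm \<psi> \<sigma> ?u \<le> ennreal (\<delta> / 2)" .
    also have lt: "ennreal (\<delta> / 2) < ennreal \<delta>"
      using \<delta>(1) by (intro ennreal_lessI) auto
    finally have small: "zygmund_norm \<psi> \<sigma> ?u < ennreal \<delta>" .
    have "zygmund_norm \<psi> \<sigma> ?u < \<infinity>"
      using small by (rule order.strict_trans) simp
    then have mem: "?u \<in> zygmund_space \<psi> \<sigma>"
      using tempered_dist_of[OF Um U'(2)] by (simp add: zygmund_space_def)
    then obtain v where v: "fourier_multiplier m ?u v"
      using cont unfolding zygmund_continuous_def by blast
    have v1: "zygmund_norm \<psi> s v < 1" using \<delta>(2)[OF mem v small] .
    let ?\<theta> = "lp_symbol \<psi> j"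
    have \<theta>: "test_function ?\<theta>" by (rule test_function_lp_symbol[OF cut])
    then have \<theta>i: "integrable lborel ?\<theta>" using test_functionE by blast
    have m\<theta>: "integrable lborel (\<lambda>\<xi>. m \<xi> * ?\<theta> \<xi>)"
      by (rule integrable_bounded_mult[OF \<theta>i m])
    \<comment> \<open>\<open>n\<close> is so large that the dilated cutoff is 1 for |\<xi>| \<le>
      max R b 2^j. This covers the block symbol, as the definition of the multiplier demands, and
      also the support of \<open>w'\<close>, so that \<eta>(D)u is u itself.\<close>
    obtain n :: nat where n: "max R b / r * 2 ^ j < 2 ^ n"
      using real_arch_pow[of 2 "max R b / r * 2 ^ j"] by auto
    define \<eta> where "\<eta> \<xi> = complex_of_real (\<psi> (\<xi> /\<^sub>R 2 ^ n))" for \<xi>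
    have \<eta>: "test_function \<eta>" unfolding \<eta>_def by (rule test_function_scaleR[OF t]) simp
    then have \<eta>i: "integrable lborel \<eta>" using test_functionE by blast
    have \<eta>1: "\<eta> \<xi> = 1" if "norm \<xi> \<le> max R b * 2 ^ j" for \<xi>
    proof -
      have "norm \<xi> \<le> r * 2 ^ n" using that n rR(1) by (simp add: field_simps)
      then show ?thesis using rR(1) rR(3)[of "\<xi> /\<^sub>R 2 ^ n"] by (simp add: \<eta>_def field_simps)
    qed
    have \<theta>\<eta>: "\<eta> \<xi> = 1" if "?\<theta> \<xi> \<noteq> 0" for \<xi>
    proof -
      have "norm \<xi> \<le> R * 2 ^ j"
      proof (rule ccontr)
        assume *: "\<not> norm \<xi> \<le> R * 2 ^ j"
        have "\<psi> (\<xi> /\<^sub>R 2 ^ i) = 0" if "i \<le> j" for i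
        proof (rule rR(4))
          have "R * 2 ^ i \<le> R * 2 ^ j" using that rR by simp
          then show "R \<le> norm (\<xi> /\<^sub>R 2 ^ i)" using * by (simp add: field_simps)
        qed
        from this[of j] this[of "j - 1"] show False
          using that by (auto simp: lp_symbol_def split: if_splits)
      qed
      also have "\<dots> \<le> max R b * 2 ^ j" by (intro mult_right_mono) auto
      finally show ?thesis by (rule \<eta>1)
    qed
    have w\<eta>: "(\<lambda>\<xi>. \<eta> \<xi> * w' \<xi>) = w'"
    proof
      fix \<xi>
      have "norm \<xi> \<le> max R b * 2 ^ j" if "w' \<xi> \<noteq> 0"
      proof -
        have "norm \<xi> \<le> b * 2 ^ j" using w'(2)[OF that] by simp
        also have "\<dots> \<le> max R b * 2 ^ j" by (intro mult_right_mono) auto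
        finally show ?thesis .
      qed
      then show "\<eta> \<xi> * w' \<xi> = w' \<xi>" using \<eta>1 by (cases "w' \<xi> = 0") auto
    qed
    have \<eta>u: "smooth_multiplier \<eta> ?u x = inv_fourier w' x" for x
      by (simp add: smooth_multiplier_dist_of[OF U'(1) \<eta>i] hat w\<eta>)
    \<comment> \<open>The defining identity of the multiplier at the origin, with the block symbol
      as \<theta>. The convolution theorem turns it into a plain frequency integral.\<close>
    have "lp_block \<psi> j v 0 = (LINT y|lborel. inv_fourier (\<lambda>\<xi>. m \<xi> * ?\<theta> \<xi>) y * smooth_multiplier \<eta> ?u (0 - y))"
      using v \<theta> \<eta> \<theta>\<eta> unfolding fourier_multiplier_def lp_block_def by blast
    also have "\<dots> = (LINT y|lborel. inv_fourier w' y * inv_fourier (\<lambda>\<xi>. m \<xi> * ?\<theta> \<xi>) (0 - y))"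
      unfolding \<eta>u
      by (subst integral_lborel_reflect[of _ 0, symmetric]) (simp add: mult.commute)
    also have "\<dots> = inv_fourier (\<lambda>\<xi>. m \<xi> * ?\<theta> \<xi> * fourier (inv_fourier w') \<xi>) 0"
      by (rule integral_mult_inv_fourier[OF U'(1) m\<theta>])
    also have "\<dots> = (LINT \<xi>|lborel. complex_of_real c * (m \<xi> * ?\<theta> \<xi> * w \<xi>)) / complex_of_real P"
      by (simp add: hat inv_fourier_def P_def w'_def mult_ac)
    also have "\<dots> = c / P * (LINT \<xi>|lborel. m \<xi> * ?\<theta> \<xi> * w \<xi>)"
      unfolding integral_mult_right_zero by simp
    finally have v0: "norm (lp_block \<psi> j v 0) = c / P * norm (LINT \<xi>|lborel. m \<xi> * ?\<theta> \<xi> * w \<xi>)"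
      using c P by (simp add: norm_mult norm_divide)
    have "ennreal (2 powr (real j * s) * norm (lp_block \<psi> j v 0)) \<le> ennreal (2 powr (real j * s)) * sup_norm (lp_block \<psi> j v)"
      unfolding sup_norm_def by (subst ennreal_mult) (auto intro!: mult_left_mono SUP_upper)
    also have "\<dots> \<le> zygmund_norm \<psi> s v"
      unfolding zygmund_norm_def by (rule SUP_upper) simp
    finally have "ennreal (2 powr (real j * s) * norm (lp_block \<psi> j v 0)) < 1"
      using v1 by (rule order.strict_trans1)
    then have "2 powr (real j * s) * norm (lp_block \<psi> j v 0) < 1"
      by (simp add: ennreal_less_one_iff)
    then have "2 powr (real j * s) * norm (LINT \<xi>|lborel. m \<xi> * ?\<theta> \<xi> * w \<xi>) \<le> P / c"
      using c P by (simp add: v0 field_simps)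
    also have "P / c = (2 * C * P / \<delta>) * 2 powr (real j * \<sigma>) * S"
      by (simp add: c_def)
    finally show ?thesis .
  qed
  moreover have "0 < 2 * C * P / \<delta>" using C P \<delta> by simp
  ultimately show ?thesis using that by blast
qed

section \<open>Wave packets\<close>

text \<open>A superposition, over \<open>\<kappa> \<in> B\<close>, of wave packets with frequency \<open>l \<kappa>\<close> and frequency width \<open>r\<close>; in
  physical space the packet of \<open>\<kappa>\<close> is located at \<open>- V \<kappa>\<close>.\<close>

definition packets ::
    "('a::euclidean_space \<Rightarrow> complex) \<Rightarrow> 'a set \<Rightarrow> ('a \<Rightarrow> real) \<Rightarrow> ('a \<Rightarrow> 'a) \<Rightarrow> real \<Rightarrow> real \<Rightarrow> 'a \<Rightarrow> complex" where
  "packets \<Phi> B A V l r \<xi> =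
    (LINT \<kappa>|lborel. indicator B \<kappa> * cis (A \<kappa> + V \<kappa> \<bullet> \<xi>) * \<Phi> ((\<xi> - l *\<^sub>R \<kappa>) /\<^sub>R r))"

lemma peak_antimono: "norm y \<le> norm x \<Longrightarrow> peak (x::'a::euclidean_space) \<le> peak (y::'a)"
  by (intro le_imp_inverse_le power_mono zero_less_power) (auto simp: add_pos_nonneg)

text \<open>Collects what does not depend on the phase: \<open>A\<close> and \<open>V\<close> are
  specialized later to its linearization. Continuity of \<open>V\<close> is asked on
  \<open>B\<close> because the gradient of |\<xi>|^\<alpha> may be discontinuous at 0.\<close>

locale wave_packets =
  fixes \<Phi> :: "'a::euclidean_space \<Rightarrow> complex" and B :: "'a set" and A :: "'a \<Rightarrow> real" and V :: "'a \<Rightarrow> 'a"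
    and l r :: real
  assumes \<Phi>: "test_function \<Phi>" and B: "compact B"
    and A: "A \<in> borel_measurable borel" and V: "V \<in> borel_measurable borel" "continuous_on B V"
    and l: "0 < l" and r: "0 < r"
begin

definition integrand :: "'a \<Rightarrow> 'a \<Rightarrow> complex" where
  "integrand \<xi> \<kappa> = indicator B \<kappa> * cis (A \<kappa> + V \<kappa> \<bullet> \<xi>) * \<Phi> ((\<xi> - l *\<^sub>R \<kappa>) /\<^sub>R r)"

lemma packets_eq: "packets \<Phi> B A V l r = (\<lambda>\<xi>. LINT \<kappa>|lborel. integrand \<xi> \<kappa>)"
  by (rule ext) (simp add: packets_def integrand_def)

lemma measurable_packet_data [measurable]:
  "\<Phi> \<in> borel_measurable borel" "A \<in> borel_measurable borel" "V \<in> borel_measurable borel" "B \<in> sets borel"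
  using test_functionE[OF \<Phi>] A V B
  by (auto intro: borel_measurable_continuous_onI borel_compact)

lemma measurable_integrand_snd [measurable]: "integrand \<xi> \<in> borel_measurable borel"
  unfolding integrand_def[abs_def] by measurable

lemma integrable_indicator_B: "integrable lborel (indicator B :: 'a \<Rightarrow> real)"
  using emeasure_compact_finite[OF B] by (intro integrable_real_indicator) (auto simp: infinity_ennreal_def)

text \<open>A majorant with separated variables, as Fubini requires. The packet at
  \<open>l *\<^sub>R \<kappa>\<close> has radius proportional to \<open>r\<close>, so all packets
  lie in one ball.\<close>

lemma integrand_bound:
  obtains C R where "0 < C" "0 < R" "\<And>\<xi> \<kappa>. norm (integrand \<xi> \<kappa>) \<le> (C * indicator (cball 0 R) \<xi>) * indicator B \<kappa>"
proof -
  obtain R0 where R0: "0 < R0" "\<And>x. R0 < norm x \<Longrightarrow> \<Phi> x = 0" "continuous_on UNIV \<Phi>"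
    using test_functionE[OF \<Phi>] by metis
  obtain C where C: "0 < C" "\<And>x. norm (\<Phi> x) \<le> C"
    using bounded_compact_support[OF R0(3,2)] by metis
  obtain b where b: "0 < b" "\<And>\<kappa>. \<kappa> \<in> B \<Longrightarrow> norm \<kappa> \<le> b"
    using compact_imp_bounded[OF B] bounded_pos by metis
  have "norm (integrand \<xi> \<kappa>) \<le> (C * indicator (cball 0 (R0 * r + l * b)) \<xi>) * indicator B \<kappa>" for \<xi> \<kappa>
  proof (cases "\<kappa> \<in> B \<and> R0 * r + l * b < norm \<xi>")
    case True
    have "norm \<xi> \<le> norm (\<xi> - l *\<^sub>R \<kappa>) + norm (l *\<^sub>R \<kappa>)"
      by (metis add.commute norm_triangle_sub)
    also have "norm (l *\<^sub>R \<kappa>) \<le> l * b" using b(2) True l by simp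
    finally have "R0 * r < norm (\<xi> - l *\<^sub>R \<kappa>)" using True by simp
    moreover have "norm ((\<xi> - l *\<^sub>R \<kappa>) /\<^sub>R r) = norm (\<xi> - l *\<^sub>R \<kappa>) / r"
      using r by (simp add: divide_inverse mult.commute)
    ultimately have "\<Phi> ((\<xi> - l *\<^sub>R \<kappa>) /\<^sub>R r) = 0" using r by (intro R0(2)) (simp add: pos_less_divide_eq)
    then show ?thesis using C(1) by (simp add: integrand_def)
  next
    case False
    then show ?thesis using C by (auto simp: integrand_def norm_mult indicator_def)
  qed
  then show ?thesis using that[of C "R0 * r + l * b"] C(1) R0(1) b(1) l r by (simp add: add_pos_pos)
qed

lemma packets_compact_support:
  obtains R where "\<And>\<xi>. R < norm \<xi> \<Longrightarrow> packets \<Phi> B A V l r \<xi> = 0"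
proof -
  obtain C R where CR: "0 < C" "\<And>\<xi> \<kappa>. norm (integrand \<xi> \<kappa>) \<le> (C * indicator (cball 0 R) \<xi>) * indicator B \<kappa>"
    using integrand_bound by metis
  have "integrand \<xi> = (\<lambda>_. 0)" if "R < norm \<xi>" for \<xi>
    using CR(2)[of \<xi>] that by (intro ext) simp
  then show ?thesis by (intro that[of R]) (simp add: packets_eq)
qed

lemma packets_nonzeroE:
  assumes "packets \<Phi> B A V l r \<xi> \<noteq> 0"
  obtains \<kappa> z where "\<kappa> \<in> B" "\<Phi> z \<noteq> 0" "\<xi> = l *\<^sub>R \<kappa> + r *\<^sub>R z"
proof -
  have "\<exists>\<kappa>. integrand \<xi> \<kappa> \<noteq> 0"
    using assms unfolding packets_eq by (metis integral_zero ext)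
  then obtain \<kappa> where "\<kappa> \<in> B" "\<Phi> ((\<xi> - l *\<^sub>R \<kappa>) /\<^sub>R r) \<noteq> 0"
    by (auto simp: integrand_def indicator_def split: if_splits)
  then show ?thesis using r that[of \<kappa> "(\<xi> - l *\<^sub>R \<kappa>) /\<^sub>R r"] by simp
qed

lemma continuous_packets: "continuous_on UNIV (packets \<Phi> B A V l r)"
proof -
  obtain C R where CR: "0 < C" "\<And>\<xi> \<kappa>. norm (integrand \<xi> \<kappa>) \<le> (C * indicator (cball 0 R) \<xi>) * indicator B \<kappa>"
    using integrand_bound by metis
  have bd: "norm (integrand \<xi> \<kappa>) \<le> C * indicator B \<kappa>" for \<xi> \<kappa>
    by (rule order_trans[OF CR(2)]) (use CR(1) in \<open>auto simp: indicator_def\<close>)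
  have "continuous_on UNIV \<Phi>" using test_functionE[OF \<Phi>] by metis
  then have c\<Phi>: "isCont \<Phi> x" for x by (simp add: continuous_on_eq_continuous_at)
  have "isCont (packets \<Phi> B A V l r) x" for x
    unfolding continuous_at_sequentially comp_def packets_eq
  proof (intro allI impI)
    fix y :: "nat \<Rightarrow> 'a" assume y: "y \<longlonglongrightarrow> x"
    show "(\<lambda>n. LINT \<kappa>|lborel. integrand (y n) \<kappa>) \<longlonglongrightarrow> (LINT \<kappa>|lborel. integrand x \<kappa>)"
    proof (rule integral_dominated_convergence)
      show "integrable lborel (\<lambda>\<kappa>. C * indicator B \<kappa>)"
        by (intro integrable_mult_right integrable_indicator_B)
      show "AE \<kappa> in lborel. (\<lambda>n. integrand (y n) \<kappa>) \<longlonglongrightarrow> integrand x \<kappa>"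
        unfolding integrand_def using y
        by (intro AE_I2 tendsto_intros isCont_tendsto_compose[OF c\<Phi>])
    qed (use bd in auto)
  qed
  then show ?thesis by (simp add: continuous_on_eq_continuous_at)
qed

lemma integrable_packets: "integrable lborel (packets \<Phi> B A V l r)"
  using integrable_compact_support[OF continuous_packets] packets_compact_support by metis

text \<open>Taken with a pure exponential \<open>g\<close> to pass to physical space, and with the
  multiplier times a block symbol for the lower bound.\<close>

lemma integral_mult_packets:
  assumes g: "g \<in> borel_measurable borel" "\<And>\<xi>. norm (g \<xi>) \<le> 1"
  shows "(LINT \<xi>|lborel. g \<xi> * packets \<Phi> B A V l r \<xi>) = (LINT \<kappa>|lborel. LINT \<xi>|lborel. g \<xi> * integrand \<xi> \<kappa>)"
    and "integrable lborel (\<lambda>\<kappa>. LINT \<xi>|lborel. g \<xi> * integrand \<xi> \<kappa>)"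
proof -
  obtain C R where CR: "0 < C" "\<And>\<xi> \<kappa>. norm (integrand \<xi> \<kappa>) \<le> (C * indicator (cball 0 R) \<xi>) * indicator B \<kappa>"
    using integrand_bound by metis
  have m1: "(\<lambda>(\<xi>, \<kappa>). g \<xi> * integrand \<xi> \<kappa>) \<in> borel_measurable (borel \<Otimes>\<^sub>M borel)"
    and m2: "(\<lambda>(\<kappa>, \<xi>). g \<xi> * integrand \<xi> \<kappa>) \<in> borel_measurable (borel \<Otimes>\<^sub>M borel)"
    unfolding integrand_def using g(1) by measurable
  have i: "integrable lborel (\<lambda>\<xi>. C * indicator (cball 0 R) (\<xi>::'a) :: real)"
    by (intro integrable_mult_right integrable_real_indicator) (auto simp: emeasure_lborel_cball_finite[unfolded infinity_ennreal_def])
  have bd: "norm (g \<xi> * integrand \<xi> \<kappa>) \<le> (C * indicator (cball 0 R) \<xi>) * indicator B \<kappa>" for \<xi> \<kappa>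
  proof -
    have "norm (g \<xi> * integrand \<xi> \<kappa>) \<le> norm (integrand \<xi> \<kappa>)"
      using g(2)[of \<xi>] by (simp add: norm_mult mult_left_le_one_le)
    then show ?thesis using CR(2) order_trans by blast
  qed
  have bd': "norm (g \<xi> * integrand \<xi> \<kappa>) \<le> indicator B \<kappa> * (C * indicator (cball 0 R) \<xi>)" for \<xi> \<kappa>
    using bd[of \<xi> \<kappa>] by (simp add: mult_ac)
  show "(LINT \<xi>|lborel. g \<xi> * packets \<Phi> B A V l r \<xi>) = (LINT \<kappa>|lborel. LINT \<xi>|lborel. g \<xi> * integrand \<xi> \<kappa>)"
    unfolding packets_eq integral_mult_right_zero[symmetric]
    by (rule integral_swap_dominated[OF m1 i integrable_indicator_B bd])
  show "integrable lborel (\<lambda>\<kappa>. LINT \<xi>|lborel. g \<xi> * integrand \<xi> \<kappa>)"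
    by (rule integrable_integral_dominated[OF m2 integrable_indicator_B i bd'])
qed

lemma integral_integrand:
  fixes g :: "'a \<Rightarrow> complex"
  shows "(LINT \<xi>|lborel. g \<xi> * integrand \<xi> \<kappa>) = r ^ DIM('a) *
    (LINT z|lborel. g (l *\<^sub>R \<kappa> + r *\<^sub>R z) * (indicator B \<kappa> * cis (A \<kappa> + V \<kappa> \<bullet> (l *\<^sub>R \<kappa> + r *\<^sub>R z)) * \<Phi> z))"
  by (subst integral_lborel_affine[of r _ "l *\<^sub>R \<kappa>"]) (use r in \<open>simp_all add: integrand_def scaleR_conv_of_real\<close>)

text \<open>Substituting \<xi> = l \<kappa> + r z exhibits each packet as a modulated copy of
  \<open>inv_fourier \<Phi>\<close> at scale 1/r, centred at -V \<kappa>.\<close>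

lemma inv_fourier_packets:
  "inv_fourier (packets \<Phi> B A V l r) x =
    (LINT \<kappa>|lborel. r ^ DIM('a) * (indicator B \<kappa> * cis (A \<kappa> + (x + V \<kappa>) \<bullet> (l *\<^sub>R \<kappa>)) * inv_fourier \<Phi> (r *\<^sub>R (x + V \<kappa>))))"
proof -
  define P where "P = complex_of_real ((2 * pi) ^ DIM('a))"
  have P: "P \<noteq> 0" by (simp add: P_def)
  have [measurable]: "(\<lambda>\<xi>. cis (x \<bullet> \<xi>)) \<in> borel_measurable borel" by measurable
  have inner: "(LINT \<xi>|lborel. cis (x \<bullet> \<xi>) * integrand \<xi> \<kappa>) =
      r ^ DIM('a) * (indicator B \<kappa> * cis (A \<kappa> + (x + V \<kappa>) \<bullet> (l *\<^sub>R \<kappa>)) * inv_fourier \<Phi> (r *\<^sub>R (x + V \<kappa>))) * P" for \<kappa>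
  proof -
    have eq: "cis (x \<bullet> (l *\<^sub>R \<kappa> + r *\<^sub>R z)) * (indicator B \<kappa> * cis (A \<kappa> + V \<kappa> \<bullet> (l *\<^sub>R \<kappa> + r *\<^sub>R z)) * \<Phi> z) =
        (indicator B \<kappa> * cis (A \<kappa> + (x + V \<kappa>) \<bullet> (l *\<^sub>R \<kappa>))) * (\<Phi> z * cis ((r *\<^sub>R (x + V \<kappa>)) \<bullet> z))" for z
    proof -
      have "cis (x \<bullet> (l *\<^sub>R \<kappa> + r *\<^sub>R z)) * cis (A \<kappa> + V \<kappa> \<bullet> (l *\<^sub>R \<kappa> + r *\<^sub>R z)) =
        cis (A \<kappa> + (x + V \<kappa>) \<bullet> (l *\<^sub>R \<kappa>)) * cis ((r *\<^sub>R (x + V \<kappa>)) \<bullet> z)"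
        by (simp add: cis_mult inner_add_left inner_add_right algebra_simps)
      then show ?thesis by (simp add: mult_ac)
    qed
    have "(LINT z|lborel. cis (x \<bullet> (l *\<^sub>R \<kappa> + r *\<^sub>R z)) * (indicator B \<kappa> * cis (A \<kappa> + V \<kappa> \<bullet> (l *\<^sub>R \<kappa> + r *\<^sub>R z)) * \<Phi> z)) =
      (indicator B \<kappa> * cis (A \<kappa> + (x + V \<kappa>) \<bullet> (l *\<^sub>R \<kappa>))) * (LINT z|lborel. \<Phi> z * cis ((r *\<^sub>R (x + V \<kappa>)) \<bullet> z))"
      unfolding eq integral_mult_right_zero ..
    then show ?thesis
      unfolding integral_integrand inv_fourier_def P_def[symmetric] using P by simp
  qed
  have "inv_fourier (packets \<Phi> B A V l r) x * P = (LINT \<xi>|lborel. cis (x \<bullet> \<xi>) * packets \<Phi> B A V l r \<xi>)"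
    using P unfolding inv_fourier_def P_def[symmetric] by (simp add: mult.commute)
  also have "\<dots> = (LINT \<kappa>|lborel. LINT \<xi>|lborel. cis (x \<bullet> \<xi>) * integrand \<xi> \<kappa>)"
    by (rule integral_mult_packets(1)) simp_all
  also have "\<dots> = (LINT \<kappa>|lborel. r ^ DIM('a) * (indicator B \<kappa> * cis (A \<kappa> + (x + V \<kappa>) \<bullet> (l *\<^sub>R \<kappa>)) * inv_fourier \<Phi> (r *\<^sub>R (x + V \<kappa>)))) * P"
    unfolding inner integral_mult_left_zero ..
  finally show ?thesis using P by simp
qed

text \<open>All oscillation is discarded. The free majorant \<open>g\<close> serves two purposes:
  decay in \<open>x\<close> for integrability, and a sharp uniform bound under separation.\<close>

lemma norm_inv_fourier_packets_le:
  assumes C: "\<And>x. norm (inv_fourier \<Phi> x) \<le> C * peak x" "0 < C"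
    and g: "integrable lborel g" "\<And>\<kappa>. \<kappa> \<in> B \<Longrightarrow> peak (r *\<^sub>R (x + V \<kappa>)) \<le> g \<kappa>" "\<And>\<kappa>. 0 \<le> g \<kappa>"
  shows "norm (inv_fourier (packets \<Phi> B A V l r) x) \<le> r ^ DIM('a) * (C * (LINT \<kappa>|lborel. g \<kappa>))"
proof -
  have "norm (inv_fourier (packets \<Phi> B A V l r) x) \<le>
    (LINT \<kappa>|lborel. norm (r ^ DIM('a) * (indicator B \<kappa> * cis (A \<kappa> + (x + V \<kappa>) \<bullet> (l *\<^sub>R \<kappa>)) * inv_fourier \<Phi> (r *\<^sub>R (x + V \<kappa>)))))"
    unfolding inv_fourier_packets by (rule integral_norm_bound)
  also have "\<dots> \<le> (LINT \<kappa>|lborel. r ^ DIM('a) * (C * g \<kappa>))"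
  proof (rule integral_mono')
    fix \<kappa>
    have "norm (indicator B \<kappa> * inv_fourier \<Phi> (r *\<^sub>R (x + V \<kappa>))) \<le> C * g \<kappa>"
    proof (cases "\<kappa> \<in> B")
      case True
      have "norm (inv_fourier \<Phi> (r *\<^sub>R (x + V \<kappa>))) \<le> C * peak (r *\<^sub>R (x + V \<kappa>))" by (rule C(1))
      also have "\<dots> \<le> C * g \<kappa>" using g(2)[OF True] C(2) by simp
      finally show ?thesis using True by simp
    qed (use g(3) C(2) in simp)
    then show "norm (r ^ DIM('a) * (indicator B \<kappa> * cis (A \<kappa> + (x + V \<kappa>) \<bullet> (l *\<^sub>R \<kappa>)) * inv_fourier \<Phi> (r *\<^sub>R (x + V \<kappa>)))) \<le>
        r ^ DIM('a) * (C * g \<kappa>)"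
      using r by (simp add: norm_mult norm_power)
  qed (use g r C(2) in auto)
  finally show ?thesis by simp
qed

text \<open>A qualitative statement, with constants that may depend on \<open>r\<close> and
  \<open>V\<close>. As \<open>V\<close> is bounded on \<open>B\<close>, the weights about the
  centres -V \<kappa> are comparable to the weight about 0, by a Peetre-type inequality.\<close>

lemma integrable_inv_fourier_packets: "integrable lborel (inv_fourier (packets \<Phi> B A V l r))"
proof -
  obtain C where C: "0 < C" "\<And>x. norm (inv_fourier \<Phi> x) \<le> C * peak x"
    using inv_fourier_decay[OF \<Phi>] by blast
  have "compact (V ` B)" using V(2) B by (rule compact_continuous_image)
  then obtain L where L: "0 < L" "\<And>\<kappa>. \<kappa> \<in> B \<Longrightarrow> norm (V \<kappa>) \<le> L"
    using compact_imp_bounded bounded_pos by (metis imageI)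
  define M where "M = (1 + r * L) ^ (2 * DIM('a))"
  have M: "0 < M" using L r by (simp add: M_def add_pos_pos)
  have pk: "peak (r *\<^sub>R (x + V \<kappa>)) \<le> M * peak (r *\<^sub>R x)" if "\<kappa> \<in> B" for x \<kappa>
  proof -
    have n: "norm (r *\<^sub>R x) \<le> norm (r *\<^sub>R (x + V \<kappa>)) + r * L"
    proof -
      have "norm x \<le> norm (x + V \<kappa>) + norm (V \<kappa>)" by (metis add_diff_cancel norm_triangle_ineq4)
      also have "\<dots> \<le> norm (x + V \<kappa>) + L" using L(2)[OF that] by simp
      finally show ?thesis using mult_left_mono[of "norm x" "norm (x + V \<kappa>) + L" r] r by (simp add: distrib_left)
    qed
    have "1 + norm (r *\<^sub>R x) \<le> (1 + r * L) * (1 + norm (r *\<^sub>R (x + V \<kappa>)))"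
    proof -
      have "0 \<le> r * L * norm (r *\<^sub>R (x + V \<kappa>))" using r L by simp
      then show ?thesis using n by (simp add: algebra_simps)
    qed
    then have "(1 + norm (r *\<^sub>R x)) ^ (2 * DIM('a)) \<le> ((1 + r * L) * (1 + norm (r *\<^sub>R (x + V \<kappa>)))) ^ (2 * DIM('a))"
      by (intro power_mono) auto
    also have "\<dots> = M * (1 + norm (r *\<^sub>R (x + V \<kappa>))) ^ (2 * DIM('a))"
      by (simp add: M_def power_mult_distrib)
    finally have *: "(1 + norm (r *\<^sub>R x)) ^ (2 * DIM('a)) \<le> M * (1 + norm (r *\<^sub>R (x + V \<kappa>))) ^ (2 * DIM('a))" .
    moreover have "0 < (1 + norm (r *\<^sub>R x)) ^ (2 * DIM('a))" "0 < (1 + norm (r *\<^sub>R (x + V \<kappa>))) ^ (2 * DIM('a))"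
      by (intro zero_less_power add_pos_nonneg; simp)+
    ultimately show ?thesis by (simp add: divide_simps inverse_eq_divide)
  qed
  have bd: "norm (inv_fourier (packets \<Phi> B A V l r) x) \<le> (r ^ DIM('a) * C * M * measure lborel B) * peak (r *\<^sub>R x)" for x
  proof -
    have "norm (inv_fourier (packets \<Phi> B A V l r) x) \<le> r ^ DIM('a) * (C * (LINT \<kappa>|lborel. indicator B \<kappa> * (M * peak (r *\<^sub>R x))))"
    proof (rule norm_inv_fourier_packets_le[OF C(2,1)])
      show "integrable lborel (\<lambda>\<kappa>. indicator B \<kappa> * (M * peak (r *\<^sub>R x)))"
        by (intro integrable_mult_left integrable_indicator_B)
    qed (use pk M in auto)
    then show ?thesis using B by (simp add: mult_ac)
  qed
  show ?thesis
  proof (rule Bochner_Integration.integrable_bound)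
    show "integrable lborel (\<lambda>x::'a. (r ^ DIM('a) * C * M * measure lborel B) * peak (r *\<^sub>R x))"
      using integrable_lborel_affine[OF _ integrable_peak, of r 0] r by (intro integrable_mult_right) simp
    show "inv_fourier (packets \<Phi> B A V l r) \<in> borel_measurable lborel"
      using integrable_packets by simp
    show "AE x in lborel. norm (inv_fourier (packets \<Phi> B A V l r) x) \<le> norm ((r ^ DIM('a) * C * M * measure lborel B) * peak (r *\<^sub>R x))"
      by (intro AE_I2 order_trans[OF bd]) simp
  qed
qed

text \<open>If \<open>\<kappa>\<^sub>0\<close> minimizes \<open>\<kappa> \<mapsto> |x + V \<kappa>|\<close>, then \<open>|x + V \<kappa>| \<ge> |V \<kappa> - V \<kappa>\<^sub>0| / 2\<close>: the packets are separated.\<close>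

lemma sup_inv_fourier_packets_le:
  assumes C: "\<And>x. norm (inv_fourier \<Phi> x) \<le> C * peak x" "0 < C" and "B \<noteq> {}"
    and sep: "\<And>\<kappa> \<kappa>'. \<lbrakk>\<kappa> \<in> B; \<kappa>' \<in> B\<rbrakk> \<Longrightarrow> 2 * \<nu> * norm (\<kappa> - \<kappa>') \<le> norm (V \<kappa> - V \<kappa>')" and \<nu>: "0 < \<nu>"
  shows "norm (inv_fourier (packets \<Phi> B A V l r) x) \<le> C * (LINT y|lborel. peak (y::'a)) / \<nu> ^ DIM('a)"
proof -
  have "continuous_on B (\<lambda>\<kappa>. norm (x + V \<kappa>))" by (intro continuous_intros V)
  from continuous_attains_inf[OF B \<open>B \<noteq> {}\<close> this]
  obtain \<kappa>0 where \<kappa>0: "\<kappa>0 \<in> B" "\<And>\<kappa>. \<kappa> \<in> B \<Longrightarrow> norm (x + V \<kappa>0) \<le> norm (x + V \<kappa>)" by blast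
  have rn: "0 < r * \<nu>" using r \<nu> by simp
  have "norm (inv_fourier (packets \<Phi> B A V l r) x) \<le>
      r ^ DIM('a) * (C * (LINT \<kappa>|lborel. peak (- ((r * \<nu>) *\<^sub>R \<kappa>0) + (r * \<nu>) *\<^sub>R (\<kappa>::'a))))"
  proof (rule norm_inv_fourier_packets_le[OF C])
    show "integrable lborel (\<lambda>\<kappa>::'a. peak (- ((r * \<nu>) *\<^sub>R \<kappa>0) + (r * \<nu>) *\<^sub>R \<kappa>))"
      using rn by (intro integrable_lborel_affine integrable_peak) auto
    show "peak (r *\<^sub>R (x + V \<kappa>)) \<le> peak (- ((r * \<nu>) *\<^sub>R \<kappa>0) + (r * \<nu>) *\<^sub>R \<kappa>)" if "\<kappa> \<in> B" for \<kappa>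
    proof -
      have "2 * \<nu> * norm (\<kappa> - \<kappa>0) \<le> norm (V \<kappa> - V \<kappa>0)" using sep that \<kappa>0(1) .
      also have "V \<kappa> - V \<kappa>0 = (x + V \<kappa>) - (x + V \<kappa>0)" by simp
      also have "norm \<dots> \<le> norm (x + V \<kappa>) + norm (x + V \<kappa>0)" by (rule norm_triangle_ineq4)
      also have "\<dots> \<le> 2 * norm (x + V \<kappa>)" using \<kappa>0(2)[OF that] by simp
      finally have "r * (\<nu> * norm (\<kappa> - \<kappa>0)) \<le> r * norm (x + V \<kappa>)" using r by simp
      moreover have "norm (- ((r * \<nu>) *\<^sub>R \<kappa>0) + (r * \<nu>) *\<^sub>R \<kappa>) = r * (\<nu> * norm (\<kappa> - \<kappa>0))"
      proof -
        have "- ((r * \<nu>) *\<^sub>R \<kappa>0) + (r * \<nu>) *\<^sub>R \<kappa> = (r * \<nu>) *\<^sub>R (\<kappa> - \<kappa>0)" by (simp add: scaleR_diff_right)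
        then show ?thesis using r \<nu> by (simp add: mult.assoc)
      qed
      ultimately show ?thesis using r by (intro peak_antimono) simp
    qed
  qed simp
  \<comment> \<open>The change of variables yields (r \<nu>)^(-d), and its power of \<open>r\<close>
    cancels the prefactor r^d.\<close>
  also have "\<dots> = C * (LINT y|lborel. peak (y::'a)) / \<nu> ^ DIM('a)"
    using integral_lborel_affine[of "r * \<nu>" "peak :: 'a \<Rightarrow> real" "- ((r * \<nu>) *\<^sub>R \<kappa>0)"] rn r \<nu>
    by (simp add: power_mult_distrib)
  finally show ?thesis .
qed

text \<open>The packets multiplied by \<open>g\<close> are in phase: the integrand has real part at
  least c times the profile, so nothing cancels in either integral, and the modulus dominates the
  real part.\<close>

lemma norm_integral_mult_packets_ge:
  assumes g: "g \<in> borel_measurable borel" "\<And>\<xi>. norm (g \<xi>) \<le> 1"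
    and \<Phi>_eq: "\<And>z. \<Phi> z = complex_of_real (\<phi> z)" "\<And>z. 0 \<le> \<phi> z"
    and re: "\<And>\<kappa> z. \<lbrakk>\<kappa> \<in> B; \<Phi> z \<noteq> 0\<rbrakk> \<Longrightarrow>
      c \<le> Re (g (l *\<^sub>R \<kappa> + r *\<^sub>R z) * cis (A \<kappa> + V \<kappa> \<bullet> (l *\<^sub>R \<kappa> + r *\<^sub>R z)))"
  shows "c * measure lborel B * r ^ DIM('a) * (LINT z|lborel. \<phi> z) \<le> norm (LINT \<xi>|lborel. g \<xi> * packets \<Phi> B A V l r \<xi>)"
proof -
  have \<Phi>i: "integrable lborel \<Phi>" using test_functionE[OF \<Phi>] by metis
  have \<phi>i: "integrable lborel \<phi>" using integrable_Re[OF \<Phi>i] by (simp add: \<Phi>_eq(1))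
  note g(1)[measurable]
  have inner: "indicator B \<kappa> * (r ^ DIM('a) * (c * (LINT z|lborel. \<phi> z))) \<le> Re (LINT \<xi>|lborel. g \<xi> * integrand \<xi> \<kappa>)" for \<kappa>
  proof (cases "\<kappa> \<in> B")
    case True
    let ?h = "\<lambda>z. g (l *\<^sub>R \<kappa> + r *\<^sub>R z) * cis (A \<kappa> + V \<kappa> \<bullet> (l *\<^sub>R \<kappa> + r *\<^sub>R z))"
    have i: "integrable lborel (\<lambda>z. ?h z * \<Phi> z)"
      by (rule integrable_bounded_mult[OF \<Phi>i]) (use g(2) in \<open>auto simp: norm_mult\<close>)
    have "c * (LINT z|lborel. \<phi> z) = (LINT z|lborel. c * \<phi> z)" by simp
    also have "\<dots> \<le> (LINT z|lborel. Re (?h z * \<Phi> z))"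
    proof (rule integral_mono)
      show "c * \<phi> z \<le> Re (?h z * \<Phi> z)" for z
        using re[OF True, of z] \<Phi>_eq(2)[of z] by (cases "\<phi> z = 0") (auto simp: \<Phi>_eq(1) mult_right_mono)
    qed (use \<phi>i integrable_Re[OF i] in auto)
    also have "\<dots> = Re (LINT z|lborel. ?h z * \<Phi> z)" using i by (rule integral_Re)
    finally have "r ^ DIM('a) * (c * (LINT z|lborel. \<phi> z)) \<le> r ^ DIM('a) * Re (LINT z|lborel. ?h z * \<Phi> z)"
      using r by simp
    also have "\<dots> = Re (LINT \<xi>|lborel. g \<xi> * integrand \<xi> \<kappa>)"
      unfolding integral_integrand using True by (simp add: mult.assoc flip: of_real_power)
    finally show ?thesis using True by simp
  qed (simp add: integrand_def)
  have "c * measure lborel B * r ^ DIM('a) * (LINT z|lborel. \<phi> z) =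
      (LINT \<kappa>|lborel. indicator B \<kappa> * (r ^ DIM('a) * (c * (LINT z|lborel. \<phi> z))))"
    using B by simp
  also have "\<dots> \<le> (LINT \<kappa>|lborel. Re (LINT \<xi>|lborel. g \<xi> * integrand \<xi> \<kappa>))"
    by (intro integral_mono integrable_mult_left integrable_indicator_B integrable_Re integral_mult_packets(2) g inner)
  also have "\<dots> = Re (LINT \<xi>|lborel. g \<xi> * packets \<Phi> B A V l r \<xi>)"
    unfolding integral_mult_packets(1)[OF g] by (rule integral_Re[OF integral_mult_packets(2)[OF g]])
  also have "\<dots> \<le> norm (LINT \<xi>|lborel. g \<xi> * packets \<Phi> B A V l r \<xi>)" by (rule complex_Re_le_cmod)
  finally show ?thesis .
qed

end

section \<open>The lower bound\<close>

lemma measurable_phase [measurable]: "phase \<alpha> \<in> borel_measurable borel"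
  unfolding phase_def[abs_def] by measurable

lemma measurable_phase_grad [measurable]: "phase_grad \<alpha> \<in> borel_measurable borel"
  unfolding phase_grad_def[abs_def] by measurable

lemma continuous_on_phase_grad: "0 \<notin> S \<Longrightarrow> continuous_on S (phase_grad \<alpha>)"
  unfolding phase_grad_def[abs_def] by (intro continuous_intros) auto

lemma phase_scaleR: "0 < c \<Longrightarrow> phase \<alpha> (c *\<^sub>R x) = c powr \<alpha> * phase \<alpha> x"
  by (simp add: phase_def powr_mult)

lemma cos_ge_half: "\<bar>x\<bar> \<le> 1 \<Longrightarrow> 1 / 2 \<le> cos (x :: real)"
proof -
  assume x: "\<bar>x\<bar> \<le> 1"
  have "\<bar>sin (x / 2)\<bar> \<le> \<bar>x / 2\<bar>" by (rule abs_sin_x_le_abs_x)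
  also have "\<dots> \<le> 1 / 2" using x by simp
  finally have "(sin (x / 2))\<^sup>2 \<le> (1 / 2)\<^sup>2" using power_mono[of "\<bar>sin (x / 2)\<bar>" "1 / 2" 2] by simp
  moreover have "cos x = 1 - 2 * (sin (x / 2))\<^sup>2" using cos_double_sin[of "x / 2"] by simp
  ultimately show ?thesis by (simp add: power2_eq_square)
qed

text \<open>The index is \<open>Suc n\<close> because the packets use blocks of positive index,
  whose symbols are differences of dilates.\<close>

lemma exp_bounded_imp_nonpos:
  assumes "\<And>n. 2 powr (real (Suc n) * e) \<le> k"
  shows "e \<le> 0"
proof (rule ccontr)
  assume "\<not> e \<le> 0"
  then have "1 < 2 powr e" by simp
  then obtain n where n: "k < (2 powr e) ^ n" using real_arch_pow by blast
  also have "(2 powr e) ^ n = 2 powr (real n * e)" by (simp add: powr_realpow[symmetric] powr_powr mult.commute)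
  also have "\<dots> \<le> 2 powr (real (Suc n) * e)" using \<open>\<not> e \<le> 0\<close> by (simp add: distrib_right)
  also have "\<dots> \<le> k" by (rule assms)
  finally show False by simp
qed

text \<open>Telescoping \<open>\<psi> \<eta> - \<psi> (2 \<eta>)\<close> along \<open>2\<^sup>k \<eta>\<close> shows that it cannot be \<open>\<le> 0\<close> everywhere. No monotonicity of
  \<open>\<psi>\<close> is assumed, so the positivity holds only near some point.\<close>

lemma lp_cutoff_annulus:
  fixes \<psi> :: "'a::euclidean_space \<Rightarrow> real"
  assumes "lp_cutoff \<psi>"
  obtains \<xi>0 c \<rho> where "0 < c" "0 < \<rho>" "\<rho> < norm \<xi>0"
    "\<And>\<eta>. \<eta> \<in> cball \<xi>0 \<rho> \<Longrightarrow> c \<le> \<psi> \<eta> - \<psi> (2 *\<^sub>R \<eta>)"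
proof -
  obtain r R where rR: "0 < r" "r < R" "\<And>\<xi>. norm \<xi> \<le> r \<Longrightarrow> \<psi> \<xi> = 1" "\<And>\<xi>. R \<le> norm \<xi> \<Longrightarrow> \<psi> \<xi> = 0"
    and t: "test_function (\<lambda>\<xi>. complex_of_real (\<psi> \<xi>))"
    using lp_cutoffE[OF assms] by metis
  have "continuous_on UNIV (\<lambda>\<xi>. complex_of_real (\<psi> \<xi>))"
    using t smooth_continuous_on unfolding test_function_def by blast
  from continuous_on_Re[OF this] have c\<psi>: "continuous_on UNIV \<psi>" by simp
  define D where "D \<eta> = \<psi> \<eta> - \<psi> (2 *\<^sub>R \<eta>)" for \<eta>
  have cD: "continuous_on UNIV D"
    unfolding D_def by (intro continuous_intros continuous_on_compose2[OF c\<psi>] c\<psi>) auto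
  have "\<exists>\<eta>. \<eta> \<noteq> 0 \<and> 0 < D \<eta>"
  proof (rule ccontr)
    assume "\<not> (\<exists>\<eta>. \<eta> \<noteq> 0 \<and> 0 < D \<eta>)"
    then have le: "\<psi> \<eta> \<le> \<psi> (2 *\<^sub>R \<eta>)" if "\<eta> \<noteq> 0" for \<eta> using that by (force simp: D_def)
    obtain b :: 'a where b: "b \<in> Basis" using nonempty_Basis by blast
    define \<eta> where "\<eta> = r *\<^sub>R b"
    have \<eta>: "norm \<eta> = r" "\<eta> \<noteq> 0" using b rR(1) by (auto simp: \<eta>_def)
    have "\<psi> \<eta> \<le> \<psi> (2 ^ k *\<^sub>R \<eta>)" for k
    proof (induction k)
      case (Suc k)
      then show ?case using le[of "2 ^ k *\<^sub>R \<eta>"] \<eta>(2) by simp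
    qed simp
    moreover obtain k where "R / r < 2 ^ k" using real_arch_pow[of 2 "R / r"] by auto
    then have "\<psi> (2 ^ k *\<^sub>R \<eta>) = 0" using \<eta>(1) rR(1) by (intro rR(4)) (simp add: field_simps)
    moreover have "\<psi> \<eta> = 1" using \<eta>(1) by (intro rR(3)) simp
    ultimately show False using not_one_le_zero by metis
  qed
  then obtain \<xi>0 where \<xi>0: "\<xi>0 \<noteq> 0" "0 < D \<xi>0" by blast
  have "isCont D \<xi>0" using cD by (simp add: continuous_on_eq_continuous_at)
  then obtain d where d: "0 < d" "\<And>\<eta>. dist \<eta> \<xi>0 < d \<Longrightarrow> dist (D \<eta>) (D \<xi>0) < D \<xi>0 / 2"
    using \<xi>0(2) unfolding continuous_at_eps_delta by (metis half_gt_zero)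
  define \<rho> where "\<rho> = min d (norm \<xi>0) / 2"
  have \<rho>: "0 < \<rho>" "\<rho> < norm \<xi>0" "\<rho> < d" using d(1) \<xi>0(1) by (auto simp: \<rho>_def min_def)
  have "D \<xi>0 / 2 \<le> \<psi> \<eta> - \<psi> (2 *\<^sub>R \<eta>)" if "\<eta> \<in> cball \<xi>0 \<rho>" for \<eta>
  proof -
    have "dist \<eta> \<xi>0 < d" using that \<rho>(3) by (simp add: dist_commute)
    then have "\<bar>D \<eta> - D \<xi>0\<bar> < D \<xi>0 / 2" using d(2)[of \<eta>] by (simp only: dist_real_def)
    then have "D \<xi>0 / 2 \<le> D \<eta>" by linarith
    then show ?thesis by (simp only: D_def[of \<eta>])
  qed
  then show ?thesis using that[of "D \<xi>0 / 2" \<rho> \<xi>0] \<xi>0(2) \<rho> by simp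
qed

text \<open>At unit scale all blocks of positive index have the same symbol, so its lower bound near
  one point is uniform in \<open>n\<close>.\<close>

lemma lp_symbol_dyadic:
  "lp_symbol \<psi> (Suc n) (2 ^ Suc n *\<^sub>R \<eta>) = complex_of_real (\<psi> \<eta> - \<psi> (2 *\<^sub>R \<eta>))"
  by (simp add: lp_symbol_Suc mult.left_commute)

theorem proposition8p1:
  fixes \<psi> :: "'a::euclidean_space \<Rightarrow> real" and \<alpha> s \<sigma> :: real
  assumes "lp_cutoff \<psi>"
    and "0 < \<alpha>" and "\<alpha> \<noteq> 1"
    and "\<exists>t\<^sub>0. t\<^sub>0 \<noteq> 0 \<and> zygmund_continuous \<psi> (propagator \<alpha> t\<^sub>0) \<sigma> s"
  shows "s \<le> \<sigma> - real DIM('a) * \<alpha> / 2"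
proof -
  note cut = assms(1)
  obtain t0 where t0: "t0 \<noteq> 0" and cont: "zygmund_continuous \<psi> (propagator \<alpha> t0) \<sigma> s"
    using assms(4) by blast
  define m :: "'a \<Rightarrow> complex" where "m \<xi> = cis (- (t0 * phase \<alpha> \<xi>))" for \<xi>
  have m: "m \<in> borel_measurable borel" "\<And>\<xi>. norm (m \<xi>) \<le> 1"
    unfolding m_def[abs_def] by simp_all
  have cont: "zygmund_continuous \<psi> (fourier_multiplier m) \<sigma> s"
    using cont by (simp add: propagator_def m_def[abs_def] phase_def)
  obtain r0 R where rR: "0 < r0" "r0 < R" "\<And>\<xi>. norm \<xi> \<le> r0 \<Longrightarrow> \<psi> \<xi> = 1" "\<And>\<xi>. R \<le> norm \<xi> \<Longrightarrow> \<psi> \<xi> = 0"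
    and test: "test_function (\<lambda>\<xi>. complex_of_real (\<psi> \<xi>))"
    using lp_cutoffE[OF cut] by metis
  \<comment> \<open>The cutoff itself serves as packet profile: it is a nonnegative test function
    with positive integral.\<close>
  define \<Phi> where "\<Phi> \<xi> = complex_of_real (\<psi> \<xi>)" for \<xi>
  have \<Phi>: "test_function \<Phi>" using test by (simp add: \<Phi>_def[abs_def])
  have \<psi>01: "0 \<le> \<psi> \<xi>" "\<psi> \<xi> \<le> 1" for \<xi> using cut unfolding lp_cutoff_def by blast+
  have \<Phi>R: "norm z \<le> R" if "\<Phi> z \<noteq> 0" for z using that rR(4)[of z] by (force simp: \<Phi>_def)
  define I where "I = (LINT z|lborel. \<psi> z)"
  obtain Cd where Cd: "0 < Cd" "\<And>x. norm (inv_fourier \<Phi> x) \<le> Cd * peak x"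
    using inv_fourier_decay[OF \<Phi>] by blast
  define Pk where "Pk = (LINT y|lborel. peak (y::'a)) + 1"
  have Pk: "0 < Pk" unfolding Pk_def by (intro add_nonneg_pos Bochner_Integration.integral_nonneg) auto
  obtain \<xi>0 :: 'a and c0 \<rho> where c0: "0 < c0" and \<rho>: "0 < \<rho>" "\<rho> < norm \<xi>0"
    and low: "\<And>\<eta>. \<eta> \<in> cball \<xi>0 \<rho> \<Longrightarrow> c0 \<le> \<psi> \<eta> - \<psi> (2 *\<^sub>R \<eta>)"
    using lp_cutoff_annulus[OF cut] by metis
  define a b where "a = norm \<xi>0 - \<rho>" and "b = norm \<xi>0 + \<rho>"
  have ab: "0 < a" "a \<le> b" using \<rho> by (auto simp: a_def b_def)
  have ann: "a \<le> norm \<eta>" "norm \<eta> \<le> b" if "\<eta> \<in> cball \<xi>0 \<rho>" for \<eta>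
  proof -
    have d: "norm (\<xi>0 - \<eta>) \<le> \<rho>" using that by (simp add: dist_norm)
    show "a \<le> norm \<eta>" using norm_triangle_ineq2[of \<xi>0 \<eta>] d by (simp add: a_def)
    show "norm \<eta> \<le> b" using norm_triangle_ineq2[of \<eta> \<xi>0] d by (simp add: b_def norm_minus_commute)
  qed
  \<comment> \<open>Half the radius leaves room \<rho>/2 for the width of the packets.\<close>
  define B where "B = cball \<xi>0 (\<rho> / 2)"
  have B\<rho>: "B \<subseteq> cball \<xi>0 \<rho>" using \<rho>(1) by (auto simp: B_def)
  have B0: "0 \<notin> B" "B \<noteq> {}" "compact B" using \<rho> by (auto simp: B_def)
  have I: "0 < I" and Bm: "0 < measure lborel B"
  proof -
    show "0 < measure lborel B" unfolding B_def using \<rho>(1) by (intro content_cball_pos) simp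
    have i: "integrable lborel \<psi>"
    proof -
      have "integrable lborel \<Phi>" by (rule test_functionE[OF \<Phi>])
      from integrable_Re[OF this] show ?thesis by (simp add: \<Phi>_def)
    qed
    have "0 < measure lborel (cball (0::'a) r0)" using rR(1) by (intro content_cball_pos)
    also have "\<dots> = (LINT z|lborel. indicator (cball (0::'a) r0) z)" by simp
    also have "\<dots> \<le> I"
      unfolding I_def using i rR(3) \<psi>01 by (intro integral_mono') (auto simp: indicator_def)
    finally show "0 < I" .
  qed
  obtain cg where cg: "0 < cg"
    "\<And>x y::'a. \<lbrakk>a \<le> norm x; norm x \<le> b; a \<le> norm y; norm y \<le> b\<rbrakk> \<Longrightarrow> cg * norm (x - y) \<le> norm (phase_grad \<alpha> x - phase_grad \<alpha> y)"
    using phase_grad_diff_ge[OF assms(2,3) ab] by metis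
  obtain Cq where Cq: "0 < Cq"
    "\<And>x y::'a. \<lbrakk>a \<le> norm x; norm x \<le> b; a \<le> norm y; norm y \<le> b\<rbrakk> \<Longrightarrow>
      \<bar>phase \<alpha> x - phase \<alpha> y - phase_grad \<alpha> y \<bullet> (x - y)\<bar> \<le> Cq * (norm (x - y))\<^sup>2"
    using phase_second_order[OF assms(2) ab] by metis
  \<comment> \<open>The second summand absorbs the linearization error, the third keeps packets
    within \<rho>/2 of their centre in the scaled variable, and the first ensures K \<ge> 1.\<close>
  define K where "K = 1 + \<bar>t0\<bar> * Cq * R\<^sup>2 + 2 * R / \<rho>"
  have K: "1 \<le> K" "\<bar>t0\<bar> * Cq * R\<^sup>2 \<le> K" "2 * R / \<rho> \<le> K"
  proof -
    have "0 \<le> \<bar>t0\<bar> * Cq * R\<^sup>2" "0 \<le> 2 * R / \<rho>" using Cq(1) rR(1,2) \<rho>(1) by simp_all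
    then show "1 \<le> K" "\<bar>t0\<bar> * Cq * R\<^sup>2 \<le> K" "2 * R / \<rho> \<le> K" unfolding K_def by linarith+
  qed
  obtain CB where CB: "0 < CB"
    "\<And>w j S. \<lbrakk>continuous_on UNIV w; \<And>\<xi>. w \<xi> \<noteq> 0 \<Longrightarrow> a * 2 ^ j \<le> norm \<xi> \<and> norm \<xi> \<le> b * 2 ^ j;
       integrable lborel (inv_fourier w); \<And>x. norm (inv_fourier w x) \<le> S; 0 < S\<rbrakk> \<Longrightarrow>
      2 powr (real j * s) * norm (LINT \<xi>|lborel. m \<xi> * lp_symbol \<psi> j \<xi> * w \<xi>) \<le> CB * 2 powr (real j * \<sigma>) * S"
    by (rule zygmund_continuous_imp_bound[OF cut cont m ab]) (erule that, presburger)
  define d where "d = DIM('a)"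
  define k3 where "k3 = \<bar>t0\<bar> * cg / (2 * K)"
  have k3: "0 < k3" using t0 cg(1) K(1) by (simp add: k3_def)
  define k1 where "k1 = c0 / 2 * measure lborel B * I"
  have k1: "0 < k1" using c0 Bm I by (simp add: k1_def)
  have "2 powr (real (Suc n) * (s - \<sigma> + \<alpha> * real d / 2)) \<le> CB * Cd * Pk / (k1 * k3 ^ d)" for n
  proof -
    define l :: real where "l = 2 ^ Suc n"
    have l: "0 < l" and l1: "1 \<le> l" unfolding l_def by (simp, rule one_le_power) simp
    have lpow: "l powr e = 2 powr (real (Suc n) * e)" for e
      proof -
      have "l = 2 powr real (Suc n)" unfolding l_def by (rule powr_realpow[symmetric]) simp
      then show ?thesis by (simp only: powr_powr)
    qed
    \<comment> \<open>Chosen so that l^\<alpha> (r/l)^2 = 1/K^2: the quadratic error of the phase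
      stays bounded as \<open>l\<close> grows.\<close>
    define r where "r = l powr (1 - \<alpha> / 2) / K"
    have r: "0 < r" using l K by (simp add: r_def)
    have rl: "r / l = l powr (- \<alpha> / 2) / K"
    proof -
      have "l powr (1 - \<alpha> / 2) / l = l powr ((1 - \<alpha> / 2) - 1)"
        using l powr_diff[of l "1 - \<alpha> / 2" 1] by simp
      moreover have "r / l = (l powr (1 - \<alpha> / 2) / l) / K" by (simp add: r_def mult.commute)
      ultimately show ?thesis by simp
    qed
    \<comment> \<open>Together A \<kappa> + V \<kappa>.\<xi> is the first-order Taylor polynomial of
      t0 |\<xi>|^\<alpha> at l \<kappa>, by homogeneity of the phase and its gradient. It cancels
      the multiplier up to the quadratic remainder.\<close>
    define A where "A \<kappa> = t0 * l powr \<alpha> * (phase \<alpha> \<kappa> - phase_grad \<alpha> \<kappa> \<bullet> \<kappa>)" for \<kappa> :: 'a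
    define V where "V \<kappa> = (t0 * l powr (\<alpha> - 1)) *\<^sub>R phase_grad \<alpha> \<kappa>" for \<kappa> :: 'a
    interpret wave_packets \<Phi> B A V l r
    proof
      show "A \<in> borel_measurable borel" "V \<in> borel_measurable borel"
        unfolding A_def[abs_def] V_def[abs_def] by measurable
      show "continuous_on B V"
        unfolding V_def[abs_def] by (intro continuous_intros continuous_on_phase_grad B0)
    qed (use \<Phi> B0 l r in auto)
    let ?w = "packets \<Phi> B A V l r"
    \<comment> \<open>In the variable \<eta> = \<xi>/l a packet stays within R r/l \<le> \<rho>/2 of
      \<kappa>, where the bounds on phase and cutoff hold. Since l \<ge> 1, this is true for every
      \<open>n\<close>.\<close>
    have near: "\<kappa> + (r / l) *\<^sub>R z \<in> cball \<xi>0 \<rho>" "\<bar>t0\<bar> * l powr \<alpha> * (Cq * (norm ((r / l) *\<^sub>R z))\<^sup>2) \<le> 1"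
      if "\<kappa> \<in> B" "\<Phi> z \<noteq> 0" for \<kappa> z
    proof -
      have z: "norm z \<le> R" by (rule \<Phi>R[OF that(2)])
      have n: "norm ((r / l) *\<^sub>R z) = r / l * norm z" using r l by simp
      have "l powr (- \<alpha> / 2) \<le> 1" using l l1 assms(2) powr_mono[of "- \<alpha> / 2" 0 l] by simp
      then have "r / l \<le> 1 / K" unfolding rl using K by (intro divide_right_mono) auto
      then have "r / l * norm z \<le> 1 / K * R" using z K by (intro mult_mono) auto
      also have "\<dots> \<le> \<rho> / 2" using K \<rho>(1) by (simp add: field_simps)
      finally have "norm ((r / l) *\<^sub>R z) \<le> \<rho> / 2" unfolding n .
      moreover have "dist \<xi>0 \<kappa> \<le> \<rho> / 2" using that(1) by (simp add: B_def)
      moreover have "dist \<xi>0 (\<kappa> + (r / l) *\<^sub>R z) \<le> dist \<xi>0 \<kappa> + norm ((r / l) *\<^sub>R z)"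
        using dist_triangle[of \<xi>0 "\<kappa> + (r / l) *\<^sub>R z" \<kappa>] by (simp add: dist_norm)
      ultimately have "dist \<xi>0 (\<kappa> + (r / l) *\<^sub>R z) \<le> \<rho>" by linarith
      then show "\<kappa> + (r / l) *\<^sub>R z \<in> cball \<xi>0 \<rho>" by (simp only: mem_cball)
      have "(l powr (- \<alpha> / 2))\<^sup>2 = l powr (- \<alpha>)" by (simp add: power2_eq_square flip: powr_add)
      then have "l powr \<alpha> * (r / l)\<^sup>2 = 1 / K\<^sup>2"
        unfolding rl using l by (simp add: power_divide powr_minus)
      then have "\<bar>t0\<bar> * l powr \<alpha> * (Cq * (norm ((r / l) *\<^sub>R z))\<^sup>2) = \<bar>t0\<bar> * Cq * (norm z)\<^sup>2 / K\<^sup>2"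
        unfolding n power_mult_distrib by (metis (no_types, opaque_lifting) mult.assoc mult.commute mult.right_neutral times_divide_eq_right)
      also have "\<dots> \<le> \<bar>t0\<bar> * Cq * R\<^sup>2 / K\<^sup>2"
        using z Cq(1) by (intro divide_right_mono mult_left_mono power_mono) auto
      also have "\<dots> \<le> K / K\<^sup>2" using K by (intro divide_right_mono) auto
      also have "\<dots> \<le> 1" using K(1) by (simp add: power2_eq_square)
      finally show "\<bar>t0\<bar> * l powr \<alpha> * (Cq * (norm ((r / l) *\<^sub>R z))\<^sup>2) \<le> 1" .
    qed
    have split: "l *\<^sub>R \<kappa> + r *\<^sub>R z = l *\<^sub>R (\<kappa> + (r / l) *\<^sub>R z)" for \<kappa> z :: 'a
      using l by (simp add: scaleR_add_right)
    have supp: "a * 2 ^ Suc n \<le> norm \<xi> \<and> norm \<xi> \<le> b * 2 ^ Suc n" if "?w \<xi> \<noteq> 0" for \<xi>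
    proof -
      obtain \<kappa> z where kz: "\<kappa> \<in> B" "\<Phi> z \<noteq> 0" "\<xi> = l *\<^sub>R \<kappa> + r *\<^sub>R z"
        using packets_nonzeroE[OF \<open>?w \<xi> \<noteq> 0\<close>] by metis
      have "norm \<xi> = l * norm (\<kappa> + (r / l) *\<^sub>R z)" unfolding kz(3) split using l by simp
      moreover have "l * a \<le> l * norm (\<kappa> + (r / l) *\<^sub>R z)" "l * norm (\<kappa> + (r / l) *\<^sub>R z) \<le> l * b"
        using ann[OF near(1)[OF kz(1,2)]] l by (auto intro: mult_left_mono)
      ultimately show ?thesis unfolding l_def[symmetric] by (simp add: mult.commute)
    qed
    \<comment> \<open>Half the expansion constant of \<open>V\<close>, as the separation hypothesis
      is stated with 2 \<nu>.\<close>
    define \<nu> where "\<nu> = \<bar>t0\<bar> * l powr (\<alpha> - 1) * cg / 2"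
    have \<nu>: "0 < \<nu>" using t0 l cg(1) by (simp add: \<nu>_def)
    have sep: "2 * \<nu> * norm (\<kappa> - \<kappa>') \<le> norm (V \<kappa> - V \<kappa>')" if "\<kappa> \<in> B" "\<kappa>' \<in> B" for \<kappa> \<kappa>'
    proof -
      have "\<bar>t0 * l powr (\<alpha> - 1)\<bar> * (cg * norm (\<kappa> - \<kappa>')) \<le> \<bar>t0 * l powr (\<alpha> - 1)\<bar> * norm (phase_grad \<alpha> \<kappa> - phase_grad \<alpha> \<kappa>')"
        using that B\<rho> by (intro mult_left_mono cg(2) ann) auto
      also have "\<dots> = norm (V \<kappa> - V \<kappa>')"
        unfolding V_def scaleR_diff_right[symmetric] norm_scaleR ..
      finally show ?thesis by (simp add: \<nu>_def abs_mult mult_ac)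
    qed
    have sup: "norm (inv_fourier ?w x) \<le> Cd * Pk / \<nu> ^ d" for x
    proof -
      have "norm (inv_fourier ?w x) \<le> Cd * (LINT y|lborel. peak (y::'a)) / \<nu> ^ DIM('a)"
        by (rule sup_inv_fourier_packets_le[OF Cd(2,1) B0(2) sep \<nu>])
      also have "\<dots> \<le> Cd * Pk / \<nu> ^ d"
        unfolding d_def Pk_def using Cd(1) \<nu> by (intro divide_right_mono mult_left_mono) auto
      finally show ?thesis .
    qed
    have "k1 * r ^ d \<le> norm (LINT \<xi>|lborel. (m \<xi> * lp_symbol \<psi> (Suc n) \<xi>) * ?w \<xi>)"
    proof -
      have "c0 / 2 * measure lborel B * r ^ DIM('a) * (LINT z|lborel. \<psi> z) \<le>
          norm (LINT \<xi>|lborel. (m \<xi> * lp_symbol \<psi> (Suc n) \<xi>) * ?w \<xi>)"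
      proof (rule norm_integral_mult_packets_ge)
        have "integrable lborel (lp_symbol \<psi> (Suc n))"
          using test_functionE[OF test_function_lp_symbol[OF cut]] by metis
        then have "lp_symbol \<psi> (Suc n) \<in> borel_measurable borel"
          by (rule borel_measurable_integrable_lborel)
        then show "(\<lambda>\<xi>. m \<xi> * lp_symbol \<psi> (Suc n) \<xi>) \<in> borel_measurable borel"
          using m(1) by measurable
        show "norm (m \<xi> * lp_symbol \<psi> (Suc n) \<xi>) \<le> 1" for \<xi>
        proof -
          have "\<bar>\<psi> x - \<psi> y\<bar> \<le> 1" for x y using \<psi>01[of x] \<psi>01[of y] by linarith
          then have "norm (lp_symbol \<psi> (Suc n) \<xi>) \<le> 1"
            unfolding lp_symbol_Suc of_real_diff[symmetric] norm_of_real .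
          then show ?thesis by (simp add: norm_mult m_def)
        qed
        show "c0 / 2 \<le> Re (m (l *\<^sub>R \<kappa> + r *\<^sub>R z) * lp_symbol \<psi> (Suc n) (l *\<^sub>R \<kappa> + r *\<^sub>R z) *
            cis (A \<kappa> + V \<kappa> \<bullet> (l *\<^sub>R \<kappa> + r *\<^sub>R z)))" if kz: "\<kappa> \<in> B" "\<Phi> z \<noteq> 0" for \<kappa> z
        proof -
          define \<eta> where "\<eta> = \<kappa> + (r / l) *\<^sub>R z"
          have \<eta>: "\<eta> \<in> cball \<xi>0 \<rho>" unfolding \<eta>_def by (rule near(1)[OF kz])
          have \<kappa>: "\<kappa> \<in> cball \<xi>0 \<rho>" using kz B\<rho> by blast
          \<comment> \<open>The phase left over once \<open>A\<close> and \<open>V\<close> have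
            cancelled the linear part; its modulus is at most 1.\<close>
          define x where "x = t0 * l powr \<alpha> * (phase \<alpha> \<eta> - phase \<alpha> \<kappa> - phase_grad \<alpha> \<kappa> \<bullet> (\<eta> - \<kappa>))"
          have "\<bar>x\<bar> = \<bar>t0\<bar> * l powr \<alpha> * \<bar>phase \<alpha> \<eta> - phase \<alpha> \<kappa> - phase_grad \<alpha> \<kappa> \<bullet> (\<eta> - \<kappa>)\<bar>"
            by (simp add: x_def abs_mult)
          also have "\<dots> \<le> \<bar>t0\<bar> * l powr \<alpha> * (Cq * (norm (\<eta> - \<kappa>))\<^sup>2)"
            by (intro mult_left_mono Cq(2) ann \<eta> \<kappa>) auto
          also have "\<dots> \<le> 1" using near(2)[OF kz] by (simp add: \<eta>_def)
          finally have cos: "1 / 2 \<le> cos x" by (rule cos_ge_half)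
          have AV: "A \<kappa> + V \<kappa> \<bullet> (l *\<^sub>R \<eta>) = t0 * l powr \<alpha> * (phase \<alpha> \<kappa> + phase_grad \<alpha> \<kappa> \<bullet> (\<eta> - \<kappa>))"
          proof -
            have "l powr (\<alpha> - 1) * l = l powr \<alpha>" using l by (simp add: powr_diff)
            then have "V \<kappa> \<bullet> (l *\<^sub>R \<eta>) = t0 * l powr \<alpha> * (phase_grad \<alpha> \<kappa> \<bullet> \<eta>)"
              unfolding V_def by (metis (no_types, opaque_lifting) inner_scaleR_left inner_scaleR_right mult.assoc mult.commute)
            then show ?thesis by (simp add: A_def inner_diff_right algebra_simps)
          qed
          have mc: "m (l *\<^sub>R \<eta>) * cis (A \<kappa> + V \<kappa> \<bullet> (l *\<^sub>R \<eta>)) = cis (- x)"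
            unfolding m_def cis_mult AV phase_scaleR[OF l] x_def by (simp add: algebra_simps)
          have lp: "lp_symbol \<psi> (Suc n) (l *\<^sub>R \<eta>) = complex_of_real (\<psi> \<eta> - \<psi> (2 *\<^sub>R \<eta>))"
            unfolding l_def by (rule lp_symbol_dyadic)
          have "m (l *\<^sub>R \<eta>) * lp_symbol \<psi> (Suc n) (l *\<^sub>R \<eta>) * cis (A \<kappa> + V \<kappa> \<bullet> (l *\<^sub>R \<eta>)) =
              lp_symbol \<psi> (Suc n) (l *\<^sub>R \<eta>) * (m (l *\<^sub>R \<eta>) * cis (A \<kappa> + V \<kappa> \<bullet> (l *\<^sub>R \<eta>)))"
            by (simp only: mult_ac)
          also have "\<dots> = complex_of_real (\<psi> \<eta> - \<psi> (2 *\<^sub>R \<eta>)) * cis (- x)"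
            by (simp only: lp mc)
          finally have "m (l *\<^sub>R \<eta>) * lp_symbol \<psi> (Suc n) (l *\<^sub>R \<eta>) * cis (A \<kappa> + V \<kappa> \<bullet> (l *\<^sub>R \<eta>)) =
              complex_of_real (\<psi> \<eta> - \<psi> (2 *\<^sub>R \<eta>)) * cis (- x)" .
          moreover have "c0 * (1 / 2) \<le> (\<psi> \<eta> - \<psi> (2 *\<^sub>R \<eta>)) * cos x"
            using low[OF \<eta>] cos c0 by (intro mult_mono) auto
          ultimately show ?thesis unfolding split \<eta>_def[symmetric] by (simp flip: of_real_diff)
        qed
      qed (auto simp: \<Phi>_def \<psi>01)
      then show ?thesis by (simp add: k1_def I_def d_def mult_ac)
    qed
    then have "2 powr (real (Suc n) * s) * (k1 * r ^ d) \<le>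
        2 powr (real (Suc n) * s) * norm (LINT \<xi>|lborel. m \<xi> * lp_symbol \<psi> (Suc n) \<xi> * ?w \<xi>)"
      by (intro mult_left_mono) auto
    also have "\<dots> \<le> CB * 2 powr (real (Suc n) * \<sigma>) * (Cd * Pk / \<nu> ^ d)"
      by (rule CB(2)[OF continuous_packets supp integrable_inv_fourier_packets sup])
        (use Cd(1) Pk \<nu> in auto)
    finally have "l powr s * k1 * (r * \<nu>) ^ d \<le> CB * Cd * Pk * l powr \<sigma>"
      unfolding lpow using \<nu> by (simp add: power_mult_distrib field_simps)
    \<comment> \<open>The exponents 1 - \<alpha>/2 of \<open>r\<close> and \<alpha> - 1 of \<nu> add
      up to \<alpha>/2; the power d of this product is the loss d \<alpha>/2 in the theorem.\<close>
    moreover have "(r * \<nu>) ^ d = k3 ^ d * l powr (\<alpha> * real d / 2)"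
    proof -
      have "l powr (1 - \<alpha> / 2) * l powr (\<alpha> - 1) = l powr (\<alpha> / 2)" by (simp flip: powr_add)
      then have "r * \<nu> = k3 * l powr (\<alpha> / 2)"
        unfolding r_def \<nu>_def k3_def by (simp add: field_simps)
      then show ?thesis using l by (simp add: power_mult_distrib powr_powr flip: powr_realpow)
    qed
    ultimately have "k1 * k3 ^ d * (l powr s * l powr (\<alpha> * real d / 2)) \<le> CB * Cd * Pk * l powr \<sigma>"
      by (simp add: mult_ac)
    then have "l powr s * l powr (\<alpha> * real d / 2) / l powr \<sigma> \<le> CB * Cd * Pk / (k1 * k3 ^ d)"
      using l k1 k3 by (simp add: divide_simps mult_ac)
    then show ?thesis unfolding lpow[symmetric] by (simp add: powr_diff powr_add)
  qed
  then have "s - \<sigma> + \<alpha> * real d / 2 \<le> 0" by (rule exp_bounded_imp_nonpos)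
  then show ?thesis by (simp add: d_def mult.commute)
qed

end
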